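(* Let $\mathcal{C}$ be the set of centrally symmetric, strictly convex, $C^2$ smooth closed planar curves for which the Birkhoff billiard map has a rotational invariant curve of $4$-periodic orbits (with rotation number $1/4$), and for such a curve let $h$ denote its support function with respect to its center of symmetry. Then \[\mathcal{C}=\Big\{\gamma\ :\ h^2(\psi)=c_0+\sum_{n\in 2+4\mathbb{Z}}c_ne^{in\psi},\ h+h''>0\Big\}.\] More precisely, given a $C^2$ function $h:[0,2\pi]\to\mathbb{R}$ (2$\pi$-periodic) such that $h^2(\psi)=c_0+\sum_{n\in 2+4\mathbb{Z}}c_ne^{in\psi}$ and $h+h''>0$, there exists a curve $\gamma\in\mathcal{C}$ whose support function is $h$.
   Context: The support function of a convex curve $\gamma$ with respect to the origin is $h(\psi)=\max_{X\in\gamma}\langle X,(\cos\psi,\sin\psi)\rangle$; $h(\psi)+h''(\psi)$ is the radius of curvature of $\gamma$ at the point with outer normal angle $\psi$. The Birkhoff billiard map acts on oriented lines meeting $\gamma$ by reflection at the next intersection point (angle of incidence equals angle of reflection). *)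

theory Defs
  imports "HOL-Analysis.Analysis"
begin

text \<open>A support function h (normal angle psi) of a curve with
  positive curvature determines the boundary point with outer normal cis psi:
  X(psi) = (h psi + i h'(psi)) * cis psi.\<close>

definition C2_fun :: "(real \<Rightarrow> real) \<Rightarrow> bool" where
  "C2_fun h \<longleftrightarrow> (\<forall>x. h differentiable (at x)) \<and> (\<forall>x. deriv h differentiable (at x))
     \<and> continuous_on UNIV (deriv (deriv h))"

definition periodic_2pi :: "(real \<Rightarrow> real) \<Rightarrow> bool" where
  "periodic_2pi h \<longleftrightarrow> (\<forall>x. h (x + 2 * pi) = h x)"

definition bpoint :: "(real \<Rightarrow> real) \<Rightarrow> real \<Rightarrow> complex" where
  "bpoint h psi = (complex_of_real (h psi) + \<i> * complex_of_real (deriv h psi)) * cis psi"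

text \<open>Reflection law at the vertex bpoint h b, between the chords to bpoint h a and
  bpoint h c: the sum of the two unit chord directions is orthogonal to the tangent
  i * cis b (angle of incidence = angle of reflection).\<close>
definition reflects :: "(real \<Rightarrow> real) \<Rightarrow> real \<Rightarrow> real \<Rightarrow> real \<Rightarrow> bool" where
  "reflects h a b c \<longleftrightarrow>
     (let p = bpoint h b; e1 = sgn (bpoint h a - p); e2 = sgn (bpoint h c - p)
      in Re ((e1 + e2) * cnj (\<i> * cis b)) = 0)"

text \<open>Rotational invariant curve of 4-periodic billiard orbits with rotation number 1/4:
  the invariant curve is the graph over the boundary of the chord direction from
  bpoint h psi to bpoint h (F psi); F is the (lift of the) induced circle map.\<close>
definition has_rot_inv_curve_4 :: "(real \<Rightarrow> real) \<Rightarrow> bool" where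
  "has_rot_inv_curve_4 h \<longleftrightarrow> (\<exists>F :: real \<Rightarrow> real.
      continuous_on UNIV F \<and>
      (\<forall>psi. F (psi + 2 * pi) = F psi + 2 * pi) \<and>
      (\<forall>psi. psi < F psi \<and> F psi < psi + 2 * pi) \<and>
      (\<forall>psi. (F ^^ 4) psi = psi + 2 * pi) \<and>
      (\<forall>psi. reflects h psi (F psi) (F (F psi))))"

definition fourier_cond :: "(real \<Rightarrow> real) \<Rightarrow> bool" where
  "fourier_cond h \<longleftrightarrow> (\<exists>(c0::complex) (c::int \<Rightarrow> complex). \<forall>psi.
      ((\<lambda>n. c n * cis (of_int n * psi)) has_sum (complex_of_real ((h psi)\<^sup>2) - c0))
        {n::int. n mod 4 = 2})"

end

theory Submission
  imports Defs
begin

text \<open>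
  Write X(psi) for the boundary point with outer normal angle psi, and suppose h(psi + pi) = h(psi), so
  that X(psi + pi) = -X(psi). The reflection law at X(psi + pi/2) between X(psi) and -X(psi) then
  reduces to h h'(psi) + h h'(psi + pi/2) = 0, i.e. to h^2(psi) + h^2(psi + pi/2) being constant, and under
  this condition psi -> psi + pi/2 is the circle map of an invariant curve of 4-periodic orbits.

  Conversely, let F be the circle map of such an invariant curve. Correcting the chord length by a
  potential U, the function b -> |X(b) - X(a)| - U(b) + U(a) is maximal exactly at b = F(a), and by an
  envelope argument its maximum does not depend on a. Hence the orbits of F are precisely the inscribed
  quadrilaterals of maximal perimeter. The half turn maps orbits to such quadrilaterals, hence to orbits,
  and since orbits of the increasing map F cannot cross, F(F(psi)) = psi + pi. The reflection law at two
  adjacent vertices of the parallelogram X(psi), X(F psi), -X(psi), -X(F psi) then makes the normals at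
  psi and F(psi) orthogonal, so F(psi) = psi + pi/2, which is the condition above.

  Finally, shifting by pi/2 multiplies the n-th Fourier coefficient of h^2 by i^n, and the Fourier series
  of the C^2 function h^2 converges absolutely to it (uniqueness of coefficients follows from
  Stone-Weierstrass on the circle). So h^2(psi) + h^2(psi + pi/2) is constant iff all coefficients of h^2
  outside {0} and 2 + 4Z vanish. Since h + h'' > 0, the resulting identity h^2(psi + pi) = h^2(psi)
  upgrades to h(psi + pi) = h(psi).
\<close>

section \<open>Fourier series of periodic $C^2$ functions\<close>

lemma cis_int_mult_2pi [simp]: "cis (of_int m * (2 * pi)) = 1"
  using cis_multiple_2pi[of "of_int m"] by (simp add: mult.commute)

lemma cis_eq_cis_imp_2pi_multiple:
  assumes "cis a = cis b"
  obtains k :: int where "a = b + of_int k * (2 * pi)"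
proof -
  have "sin a = sin b \<and> cos a = cos b" using assms by (simp add: complex_eq_iff)
  then obtain k :: int where "a = b + 2 * pi * of_int k" using sin_cos_eq_iff by blast
  then show thesis by (intro that[of k]) (simp add: algebra_simps)
qed

lemma cis_int_quarter_eq_minus_one_iff: "cis (of_int n * (pi / 2)) = -1 \<longleftrightarrow> n mod 4 = 2"
proof
  assume "cis (of_int n * (pi / 2)) = -1"
  then have "cis (of_int n * (pi / 2)) = cis pi" by simp
  then obtain k :: int where "of_int n * (pi / 2) = pi + of_int k * (2 * pi)"
    by (rule cis_eq_cis_imp_2pi_multiple)
  then have "of_int n * pi = (2 + 4 * of_int k) * pi" by (simp add: algebra_simps)
  then have "(of_int n :: real) = 2 + 4 * of_int k" by simp
  then have "n = 2 + 4 * k" by linarith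
  then show "n mod 4 = 2" by presburger
next
  assume "n mod 4 = 2"
  then have "of_int n * (pi / 2) = of_int (n div 4) * (2 * pi) + pi"
    by (subst div_mult_mod_eq[symmetric, of n 4]) (simp add: algebra_simps)
  then have "cis (of_int n * (pi / 2)) = cis (of_int (n div 4) * (2 * pi)) * cis pi"
    by (simp only: cis_mult)
  then show "cis (of_int n * (pi / 2)) = -1" by simp
qed

lemma periodic_int_multiple:
  assumes "\<And>t. v (t + 2 * pi) = v t"
  shows "v (t + of_int k * (2 * pi)) = v t"
proof (induction k rule: int_induct[where k = 0])
  case (step1 i)
  have "v (t + of_int (i + 1) * (2 * pi)) = v (t + of_int i * (2 * pi) + 2 * pi)"
    by (simp add: algebra_simps)
  then show ?case using assms step1 by simp
next
  case (step2 i)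
  have "v (t + of_int i * (2 * pi)) = v (t + of_int (i - 1) * (2 * pi) + 2 * pi)"
    by (simp add: algebra_simps)
  then show ?case using assms step2 by simp
qed simp

lemma periodic_reduce_to_period:
  assumes "\<And>t. v (t + 2 * pi) = v t"
  obtains t0 where "t0 \<in> {0..2 * pi}" "v t = v t0"
proof -
  define k where "k = \<lfloor>t / (2 * pi)\<rfloor>"
  have "of_int k \<le> t / (2 * pi)" "t / (2 * pi) < of_int k + 1" unfolding k_def by linarith+
  then have "t - of_int k * (2 * pi) \<in> {0..2 * pi}" by (auto simp: field_simps)
  moreover have "v t = v (t - of_int k * (2 * pi))"
    using periodic_int_multiple[of v, OF assms, of "t - of_int k * (2 * pi)" k] by simp
  ultimately show thesis by (rule that)
qed

lemma periodic_deriv: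
  assumes "\<And>t. (f has_real_derivative f' t) (at t)" and "\<And>t. f (t + c) = f t"
  shows "f' (t + c) = f' t"
proof -
  have "((\<lambda>s. f (s + c)) has_real_derivative f' (t + c) * 1) (at t)"
    by (rule DERIV_chain2[OF assms(1)]) (auto intro!: derivative_eq_intros)
  then have "(f has_real_derivative f' (t + c)) (at t)" using assms(2) by simp
  then show ?thesis using assms(1) DERIV_unique by blast
qed

lemma has_vector_derivative_cis_int:
  "((\<lambda>t. cis (of_int m * t)) has_vector_derivative (\<i> * of_int m * cis (of_int m * t))) (at t within S)"
proof -
  have "((\<lambda>t. cis (of_int m * t)) has_derivative
      (\<lambda>x. (of_int m * x) *\<^sub>R (\<i> * cis (of_int m * t)))) (at t within S)"
    by (intro has_derivative_cis derivative_intros)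
  moreover have "(\<lambda>x. (of_int m * x) *\<^sub>R (\<i> * cis (of_int m * t)))
      = (\<lambda>x. x *\<^sub>R (\<i> * of_int m * cis (of_int m * t)))"
    by (auto simp: fun_eq_iff scaleR_conv_of_real)
  ultimately show ?thesis unfolding has_vector_derivative_def by simp
qed

lemma has_integral_cis_int:
  "((\<lambda>t. cis (of_int m * t)) has_integral (if m = 0 then complex_of_real (2 * pi) else 0)) {0..2 * pi}"
proof (cases "m = 0")
  case True
  then show ?thesis
    using has_integral_const_real[of "1::complex" 0 "2 * pi"] by (simp add: scaleR_conv_of_real)
next
  case False
  have "((\<lambda>t. cis (of_int m * t) / (\<i> * of_int m)) has_vector_derivative
      \<i> * of_int m * cis (of_int m * x) / (\<i> * of_int m)) (at x within {0..2 * pi})" for x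
    by (intro has_vector_derivative_divide has_vector_derivative_cis_int)
  then have "((\<lambda>t. cis (of_int m * t) / (\<i> * of_int m)) has_vector_derivative cis (of_int m * x))
      (at x within {0..2 * pi})" for x
    using False by simp
  then have "((\<lambda>t. cis (of_int m * t)) has_integral
      cis (of_int m * (2 * pi)) / (\<i> * of_int m) - cis (of_int m * 0) / (\<i> * of_int m)) {0..2 * pi}"
    by (intro fundamental_theorem_of_calculus) auto
  then show ?thesis using False by simp
qed

lemma has_integral_cis_int_mult_cis_int:
  "((\<lambda>t. cis (of_int n * t) * cis (- (of_int m * t))) has_integral
     (if n = m then complex_of_real (2 * pi) else 0)) {0..2 * pi}"
proof -
  have "cis (of_int n * t) * cis (- (of_int m * t)) = cis (of_int (n - m) * t)" for t
    by (simp add: cis_mult algebra_simps)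
  then show ?thesis using has_integral_cis_int[of "n - m"] by simp
qed

inductive trig_poly :: "(real \<Rightarrow> complex) \<Rightarrow> bool" where
  monomial: "trig_poly (\<lambda>t. c * cis (of_int k * t))"
| add: "trig_poly f \<Longrightarrow> trig_poly g \<Longrightarrow> trig_poly (\<lambda>t. f t + g t)"

lemma trig_poly_cong: "trig_poly f \<Longrightarrow> (\<And>t. f t = g t) \<Longrightarrow> trig_poly g"
  by (metis ext)

lemma trig_poly_const: "trig_poly (\<lambda>t. c)"
  using trig_poly.monomial[of c 0] by simp

lemma trig_poly_mult_monomial: "trig_poly g \<Longrightarrow> trig_poly (\<lambda>t. c * cis (of_int k * t) * g t)"
proof (induction g rule: trig_poly.induct)
  case (monomial c' k')
  show ?case
    by (rule trig_poly_cong[OF trig_poly.monomial[of "c * c'" "k + k'"]])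
       (simp add: cis_mult algebra_simps)
next
  case (add f g)
  show ?case by (rule trig_poly_cong[OF trig_poly.add[OF add.IH]]) (simp add: algebra_simps)
qed

lemma trig_poly_mult: "trig_poly f \<Longrightarrow> trig_poly g \<Longrightarrow> trig_poly (\<lambda>t. f t * g t)"
proof (induction f rule: trig_poly.induct)
  case (monomial c k)
  then show ?case using trig_poly_mult_monomial by blast
next
  case (add f1 f2)
  then have "trig_poly (\<lambda>t. f1 t * g t)" "trig_poly (\<lambda>t. f2 t * g t)" by auto
  then show ?case by (rule trig_poly_cong[OF trig_poly.add]) (simp add: algebra_simps)
qed

lemma trig_poly_real_polynomial_function_cis:
  "real_polynomial_function p \<Longrightarrow> trig_poly (\<lambda>t. complex_of_real (p (cis t)))"
proof (induction p rule: real_polynomial_function.induct)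
  case (linear f)
  then have "linear f" using bounded_linear.linear by blast
  moreover have "cis t = cos t *\<^sub>R 1 + sin t *\<^sub>R \<i>" for t by (simp add: complex_eq_iff)
  ultimately have f_cis: "f (cis t) = cos t * f 1 + sin t * f \<i>" for t
    by (simp add: linear_add linear_scale)
  have "trig_poly (\<lambda>t. ((f 1 - \<i> * f \<i>) / 2) * cis (of_int 1 * t)
      + ((f 1 + \<i> * f \<i>) / 2) * cis (of_int (-1) * t))"
    by (intro trig_poly.add trig_poly.monomial)
  then show ?case
    by (rule trig_poly_cong) (simp add: f_cis complex_eq_iff cis.sel field_simps)
next
  case (const c)
  show ?case by (rule trig_poly_const)
next
  case (add f g)
  show ?case by (rule trig_poly_cong[OF trig_poly.add[OF add.IH]]) simp
next
  case (mult f g)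
  show ?case by (rule trig_poly_cong[OF trig_poly_mult[OF mult.IH]]) simp
qed

lemma has_integral_mult_trig_poly_eq_0:
  assumes "\<And>k::int. ((\<lambda>t. v t * cis (of_int k * t)) has_integral 0) {0..2 * pi}"
  shows "trig_poly f \<Longrightarrow> ((\<lambda>t. v t * f t) has_integral 0) {0..2 * pi}"
proof (induction f rule: trig_poly.induct)
  case (monomial c k)
  have "((\<lambda>t. c * (v t * cis (of_int k * t))) has_integral c * 0) {0..2 * pi}"
    by (rule has_integral_mult_right[OF assms])
  then show ?case by (simp add: algebra_simps)
next
  case (add f g)
  have "((\<lambda>t. v t * f t + v t * g t) has_integral 0 + 0) {0..2 * pi}"
    by (rule has_integral_add[OF add.IH])
  then show ?case by (simp add: algebra_simps)
qed

lemma continuous_on_sphere_periodic_Arg: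
  fixes v :: "real \<Rightarrow> 'a::real_normed_vector"
  assumes cont: "continuous_on UNIV v" and per: "\<And>t. v (t + 2 * pi) = v t"
  shows "continuous_on (sphere 0 1) (\<lambda>z. v (Arg z))"
  unfolding continuous_on_eq_continuous_within
proof
  fix z :: complex assume z: "z \<in> sphere 0 1"
  have v_cont: "continuous (at x) v" for x using cont continuous_on_eq_continuous_within by blast
  show "continuous (at z within sphere 0 1) (\<lambda>z. v (Arg z))"
  proof (cases "z \<in> \<real>\<^sub>\<le>\<^sub>0")
    case False
    have "continuous (at z) (\<lambda>z. v (Arg z))"
      by (rule continuous_at_compose[OF continuous_at_Arg[OF False] v_cont, unfolded o_def])
    then show ?thesis by (rule continuous_at_imp_continuous_within)
  next
    case True
    \<comment> \<open>Arg jumps on the negative axis; near it $v \circ Arg$ agrees with $v(Arg(-z) + \pi)$.\<close>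
    moreover have "z \<noteq> 0" using z by auto
    ultimately have "- z \<notin> \<real>\<^sub>\<le>\<^sub>0" by (auto simp: nonpos_Reals_def complex_eq_iff)
    then have "continuous (at z) (\<lambda>z. Arg (- z))"
      using continuous_at_compose[of z uminus Arg] continuous_at_Arg
      by (simp add: o_def continuous_intros)
    then have "continuous (at z) (\<lambda>z. Arg (- z) + pi)" by (intro continuous_intros)
    then have c: "continuous (at z) (\<lambda>z. v (Arg (- z) + pi))"
      by (rule continuous_at_compose[OF _ v_cont, unfolded o_def])
    have "v (Arg (- w) + pi) = v (Arg w)" if "w \<in> sphere 0 1" for w
    proof -
      have "w \<noteq> 0" using that by auto
      then have "cis (Arg (- w) + pi) = cis (Arg w)"
        by (simp add: cis_mult[symmetric] cis_Arg sgn_minus)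
      then obtain k :: int where "Arg (- w) + pi = Arg w + of_int k * (2 * pi)"
        by (rule cis_eq_cis_imp_2pi_multiple)
      then show ?thesis using periodic_int_multiple[of v, OF per] by simp
    qed
    then show ?thesis
      by (intro continuous_transform_within[OF continuous_at_imp_continuous_within[OF c], of 1])
         (use z in auto)
  qed
qed

lemma trig_poly_approx:
  fixes v :: "real \<Rightarrow> complex"
  assumes cont: "continuous_on UNIV v" and per: "\<And>t. v (t + 2 * pi) = v t" and "e > 0"
  obtains q where "trig_poly q" "\<And>t. norm (v t - q t) \<le> e"
proof -
  have Arg: "v (Arg (cis t)) = v t" for t
  proof -
    have "cis (Arg (cis t)) = cis t" by (simp add: cis_Arg sgn_cis)
    then obtain k :: int where "Arg (cis t) = t + of_int k * (2 * pi)"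
      by (rule cis_eq_cis_imp_2pi_multiple)
    then show ?thesis using periodic_int_multiple[of v, OF per] by simp
  qed
  have vc: "continuous_on (sphere 0 1) (\<lambda>z. v (Arg z))"
    by (rule continuous_on_sphere_periodic_Arg[OF cont per])
  have "e / 2 > 0" using \<open>e > 0\<close> by simp
  have "continuous_on (sphere 0 1) (\<lambda>z. Re (v (Arg z)))"
    "continuous_on (sphere 0 1) (\<lambda>z. Im (v (Arg z)))"
    using vc by (auto intro: continuous_on_Re continuous_on_Im)
  then obtain p1 p2 where p1: "real_polynomial_function p1"
      "\<And>z. z \<in> sphere 0 1 \<Longrightarrow> \<bar>Re (v (Arg z)) - p1 z\<bar> < e / 2"
    and p2: "real_polynomial_function p2"
      "\<And>z. z \<in> sphere 0 1 \<Longrightarrow> \<bar>Im (v (Arg z)) - p2 z\<bar> < e / 2"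
    using Stone_Weierstrass_real_polynomial_function[OF compact_sphere _ \<open>e / 2 > 0\<close>]
    by metis
  define q where "q t = complex_of_real (p1 (cis t)) + \<i> * complex_of_real (p2 (cis t))" for t
  show thesis
  proof
    show "trig_poly q" unfolding q_def[abs_def]
      by (rule trig_poly.add[OF trig_poly_real_polynomial_function_cis[OF p1(1)]
            trig_poly_mult[OF trig_poly_const trig_poly_real_polynomial_function_cis[OF p2(1)]]])
    fix t
    have "norm (v t - q t) \<le> \<bar>Re (v t - q t)\<bar> + \<bar>Im (v t - q t)\<bar>" by (rule cmod_le)
    also have "\<dots> = \<bar>Re (v (Arg (cis t))) - p1 (cis t)\<bar> + \<bar>Im (v (Arg (cis t))) - p2 (cis t)\<bar>"
      by (simp add: q_def Arg)
    also have "\<dots> < e" using p1(2)[of "cis t"] p2(2)[of "cis t"] by simp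
    finally show "norm (v t - q t) \<le> e" by simp
  qed
qed

lemma has_integral_norm_sq_eq_0_if_fourier_integrals_eq_0:
  fixes v :: "real \<Rightarrow> complex"
  assumes cont: "continuous_on UNIV v" and per: "\<And>t. v (t + 2 * pi) = v t"
    and coeffs: "\<And>k::int. ((\<lambda>t. v t * cis (of_int k * t)) has_integral 0) {0..2 * pi}"
  shows "((\<lambda>t. (norm (v t))\<^sup>2) has_integral 0) {0..2 * pi}"
proof -
  have "bounded (v ` {0..2 * pi})"
    by (intro compact_imp_bounded compact_continuous_image continuous_on_subset[OF cont]) auto
  then obtain M where M: "\<And>t. t \<in> {0..2 * pi} \<Longrightarrow> norm (v t) \<le> M"
    unfolding bounded_iff by blast
  have "norm (v 0) \<le> M" using M by simp
  then have "M \<ge> 0" by (rule order_trans[OF norm_ge_zero])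
  define g where "g t = (norm (v t))\<^sup>2" for t
  have "continuous_on {0..2 * pi} g"
    unfolding g_def by (intro continuous_intros continuous_on_subset[OF cont]) auto
  then obtain I where I: "(g has_integral I) {0..2 * pi}"
    using integrable_continuous_real by blast
  have "\<bar>I\<bar> \<le> d" if "d > 0" for d
  proof -
    \<comment> \<open>$\int |v|^2 = \int v\, (\overline{v} - q)$ for every trigonometric polynomial $q$.\<close>
    define e where "e = d / (2 * pi * (M + 1))"
    have "e > 0" using \<open>M \<ge> 0\<close> \<open>d > 0\<close> by (simp add: e_def)
    have "continuous_on UNIV (\<lambda>t. cnj (v t))" using cont by (intro continuous_intros)
    then obtain q where q: "trig_poly q" "\<And>t. norm (cnj (v t) - q t) \<le> e"
      by (rule trig_poly_approx) (auto simp: per \<open>e > 0\<close>)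
    have "((\<lambda>t. complex_of_real (g t)) has_integral of_real I) {0..2 * pi}"
      by (rule has_integral_of_real[OF I])
    then have "((\<lambda>t. v t * cnj (v t)) has_integral of_real I) {0..2 * pi}"
      unfolding g_def complex_norm_square .
    then have "((\<lambda>t. v t * cnj (v t) - v t * q t) has_integral of_real I - 0) {0..2 * pi}"
      by (intro has_integral_diff has_integral_mult_trig_poly_eq_0[OF coeffs q(1)])
    then have "((\<lambda>t. v t * (cnj (v t) - q t)) has_integral of_real I) {0..2 * pi}"
      by (simp add: right_diff_distrib)
    then have "norm (complex_of_real I) \<le> (M * e) * Henstock_Kurzweil_Integration.content {0..2 * pi}"
      using M q(2) \<open>M \<ge> 0\<close> \<open>e > 0\<close>
      by (intro has_integral_bound_real[where S = "{}"]) (auto simp: norm_mult intro!: mult_mono)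
    also have "\<dots> \<le> (M + 1) * e * (2 * pi)" using \<open>e > 0\<close> by simp
    also have "\<dots> = d" using \<open>M \<ge> 0\<close> by (simp add: e_def)
    finally show ?thesis by simp
  qed
  then have "\<bar>I\<bar> \<le> 0" by (rule field_le_epsilon) simp
  then show ?thesis using I unfolding g_def[abs_def] by simp
qed

lemma periodic_eq_0_if_fourier_integrals_eq_0:
  fixes v :: "real \<Rightarrow> complex"
  assumes cont: "continuous_on UNIV v" and per: "\<And>t. v (t + 2 * pi) = v t"
    and coeffs: "\<And>k::int. ((\<lambda>t. v t * cis (of_int k * t)) has_integral 0) {0..2 * pi}"
  shows "v t = 0"
proof -
  have "(norm (v x))\<^sup>2 = 0" if "x \<in> {0..2 * pi}" for x
  proof (rule has_integral_0_cbox_imp_0[of 0 "2 * pi" "\<lambda>t. (norm (v t))\<^sup>2" x])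
    show "continuous_on (cbox 0 (2 * pi)) (\<lambda>t. (norm (v t))\<^sup>2)"
      by (intro continuous_intros continuous_on_subset[OF cont]) auto
    show "((\<lambda>t. (norm (v t))\<^sup>2) has_integral 0) (cbox 0 (2 * pi))"
      using has_integral_norm_sq_eq_0_if_fourier_integrals_eq_0[OF cont per coeffs] by simp
  qed (use that in \<open>auto simp: not_le\<close>)
  moreover obtain t0 where "t0 \<in> {0..2 * pi}" "v t = v t0" by (rule periodic_reduce_to_period[of v, OF per])
  ultimately show ?thesis by simp
qed

definition fourier_coeff :: "(real \<Rightarrow> real) \<Rightarrow> int \<Rightarrow> complex" where
  "fourier_coeff u n =
     integral {0..2 * pi} (\<lambda>t. complex_of_real (u t) * cis (- (of_int n * t))) / complex_of_real (2 * pi)"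

lemma has_integral_fourier_coeff:
  assumes "continuous_on UNIV u"
  shows "((\<lambda>t. complex_of_real (u t) * cis (- (of_int n * t))) has_integral
           complex_of_real (2 * pi) * fourier_coeff u n) {0..2 * pi}"
proof -
  have "(\<lambda>t. complex_of_real (u t) * cis (- (of_int n * t))) integrable_on {0..2 * pi}"
    by (intro integrable_continuous_real continuous_intros continuous_on_subset[OF assms]) auto
  then show ?thesis unfolding fourier_coeff_def by (simp add: integrable_integral)
qed

lemma fourier_coeff_deriv:
  fixes u u' :: "real \<Rightarrow> real"
  assumes u': "\<And>t. (u has_real_derivative u' t) (at t)" and cont: "continuous_on UNIV u'"
    and per: "u (2 * pi) = u 0"
  shows "fourier_coeff u' n = \<i> * of_int n * fourier_coeff u n"
proof -
  have u_cont: "continuous_on UNIV u"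
    using u' by (intro continuous_at_imp_continuous_on) (auto intro: DERIV_isCont)
  define g where "g t = complex_of_real (u t) * cis (- (of_int n * t))" for t
  have "((\<lambda>t. complex_of_real (u' t) * cis (- (of_int n * t)) - \<i> * of_int n * g t) has_integral
      g (2 * pi) - g 0) {0..2 * pi}"
  proof (rule fundamental_theorem_of_calculus)
    fix x assume "x \<in> {0..2 * pi}"
    have "((\<lambda>t. cis (- (of_int n * t))) has_vector_derivative - (\<i> * of_int n * cis (- (of_int n * x))))
        (at x within {0..2 * pi})"
      using has_vector_derivative_cis_int[of "- n" x] by simp
    moreover have "((\<lambda>t. complex_of_real (u t)) has_vector_derivative complex_of_real (u' x))
        (at x within {0..2 * pi})"
      by (intro has_vector_derivative_of_real has_field_derivative_at_within[OF u'])
    ultimately have "(g has_vector_derivative complex_of_real (u x) * - (\<i> * of_int n * cis (- (of_int n * x)))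
        + complex_of_real (u' x) * cis (- (of_int n * x))) (at x within {0..2 * pi})"
      unfolding g_def by (rule has_vector_derivative_mult[rotated])
    then show "(g has_vector_derivative
        complex_of_real (u' x) * cis (- (of_int n * x)) - \<i> * of_int n * g x) (at x within {0..2 * pi})"
      by (simp add: g_def algebra_simps)
  qed simp
  moreover have "cis (- (of_int n * (2 * pi))) = 1"
    using cis_int_mult_2pi[of "- n"] by simp
  then have "g (2 * pi) - g 0 = 0" using per by (simp add: g_def)
  ultimately have "((\<lambda>t. complex_of_real (u' t) * cis (- (of_int n * t)) - \<i> * of_int n * g t)
      has_integral 0) {0..2 * pi}" by simp
  moreover have "((\<lambda>t. complex_of_real (u' t) * cis (- (of_int n * t)) - \<i> * of_int n * g t)
      has_integral of_real (2 * pi) * fourier_coeff u' n - \<i> * of_int n * (of_real (2 * pi) * fourier_coeff u n))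
      {0..2 * pi}"
    unfolding g_def
    by (intro has_integral_diff has_integral_mult_right has_integral_fourier_coeff cont u_cont)
  ultimately have "of_real (2 * pi) * fourier_coeff u' n - \<i> * of_int n * (of_real (2 * pi) * fourier_coeff u n) = 0"
    by (rule has_integral_unique[symmetric])
  then have "complex_of_real (2 * pi) * (fourier_coeff u' n - \<i> * of_int n * fourier_coeff u n) = 0"
    by (simp only: right_diff_distrib mult.left_commute)
  then show ?thesis by simp
qed

lemma norm_fourier_coeff_le:
  assumes "continuous_on UNIV u" and "\<And>t. t \<in> {0..2 * pi} \<Longrightarrow> \<bar>u t\<bar> \<le> B"
  shows "norm (fourier_coeff u n) \<le> B"
proof -
  have "norm (complex_of_real (2 * pi) * fourier_coeff u n)
      \<le> B * Henstock_Kurzweil_Integration.content {0..2 * pi}"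
    using assms(2) order_trans[OF abs_ge_zero assms(2)[of 0]]
    by (intro has_integral_bound_real[where S = "{}", OF _ _ has_integral_fourier_coeff[OF assms(1)]])
       (auto simp: norm_mult)
  then show ?thesis by (simp add: norm_mult)
qed

lemma summable_on_inverse_square_int: "(\<lambda>n::int. 1 / (of_int n)\<^sup>2 :: real) summable_on UNIV"
proof -
  let ?f = "\<lambda>n::int. 1 / (of_int n)\<^sup>2 :: real"
  have nat: "(\<lambda>n::nat. 1 / (real n)\<^sup>2) summable_on UNIV"
    using inverse_power_summable[of 2, where 'a = real]
    by (intro summable_nonneg_imp_summable_on) (auto simp: divide_inverse)
  have "?f summable_on range int"
    by (subst summable_on_reindex) (use nat in \<open>auto simp: o_def\<close>)
  moreover have "?f summable_on range (\<lambda>n::nat. - int n)"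
    by (subst summable_on_reindex) (use nat in \<open>auto simp: o_def inj_def\<close>)
  moreover have "UNIV = range int \<union> range (\<lambda>n::nat. - int n)"
  proof -
    have "x \<in> range int \<union> range (\<lambda>n::nat. - int n)" for x :: int
      by (cases "x \<ge> 0") (auto simp: image_iff intro: exI[of _ "nat x"] exI[of _ "nat (- x)"])
    then show ?thesis by blast
  qed
  ultimately show ?thesis by (metis summable_on_union)
qed

lemma abs_summable_fourier_coeff:
  fixes u u' u'' :: "real \<Rightarrow> real"
  assumes u': "\<And>t. (u has_real_derivative u' t) (at t)"
    and u'': "\<And>t. (u' has_real_derivative u'' t) (at t)"
    and cont: "continuous_on UNIV u''" and per: "\<And>t. u (t + 2 * pi) = u t"
  shows "(\<lambda>n. norm (fourier_coeff u n)) summable_on UNIV"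
proof -
  have cont': "continuous_on UNIV u'"
    using u'' by (intro continuous_at_imp_continuous_on) (auto intro: DERIV_isCont)
  have per': "u' (2 * pi) = u' 0" using periodic_deriv[OF u' per, of 0] by simp
  have "bounded (u'' ` {0..2 * pi})"
    by (intro compact_imp_bounded compact_continuous_image continuous_on_subset[OF cont]) auto
  then obtain B where B: "\<And>t. t \<in> {0..2 * pi} \<Longrightarrow> \<bar>u'' t\<bar> \<le> B"
    unfolding bounded_iff real_norm_def by blast
  \<comment> \<open>Integrating by parts twice gives decay $|\hat u(n)| \le B / n^2$.\<close>
  have decay: "norm (fourier_coeff u n) \<le> B / (of_int n)\<^sup>2" if "n \<noteq> 0" for n
  proof -
    have "fourier_coeff u'' n = - (of_int n)\<^sup>2 * fourier_coeff u n"
      using fourier_coeff_deriv[OF u'' cont per'] fourier_coeff_deriv[OF u' cont' per[of 0, simplified]]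
      by (simp add: power2_eq_square algebra_simps)
    then have "norm (fourier_coeff u'' n) = (of_int n)\<^sup>2 * norm (fourier_coeff u n)"
      by (simp add: norm_mult norm_power)
    moreover have "norm (fourier_coeff u'' n) \<le> B" by (rule norm_fourier_coeff_le[OF cont B])
    ultimately show ?thesis using that by (simp add: field_simps)
  qed
  show ?thesis
  proof (rule summable_on_comparison_test)
    show "(\<lambda>n. B * (1 / (of_int n)\<^sup>2) + (if n = 0 then norm (fourier_coeff u 0) else 0)) summable_on UNIV"
      by (intro summable_on_add summable_on_cmult_right summable_on_inverse_square_int)
         (rule finite_nonzero_values_imp_summable_on, auto)
    fix n :: int
    show "norm (fourier_coeff u n)
        \<le> B * (1 / (of_int n)\<^sup>2) + (if n = 0 then norm (fourier_coeff u 0) else 0)"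
      using decay[of n] by (cases "n = 0") auto
  qed simp
qed

lemma filterlim_int_symmetric_intervals:
  "filterlim (\<lambda>N::nat. {- int N..int N}) (finite_subsets_at_top UNIV) sequentially"
  unfolding filterlim_finite_subsets_at_top
proof (intro allI impI)
  fix X :: "int set" assume "finite X \<and> X \<subseteq> UNIV"
  then obtain b where b: "\<And>x. x \<in> X \<Longrightarrow> \<bar>x\<bar> \<le> b"
    using finite_imageI[of X abs] by (metis bdd_above.unfold bdd_above_finite imageI)
  have "eventually (\<lambda>N::nat. b \<le> int N) sequentially"
    using eventually_ge_at_top[of "nat b"] by eventually_elim auto
  then show "eventually (\<lambda>N. finite {- int N..int N} \<and> X \<subseteq> {- int N..int N} \<and> {- int N..int N} \<subseteq> UNIV)
      sequentially"
    by eventually_elim (use b in \<open>force simp: abs_le_iff\<close>)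
qed

definition trig_series :: "(int \<Rightarrow> complex) \<Rightarrow> real \<Rightarrow> complex" where
  "trig_series d x = (\<Sum>\<^sub>\<infinity>n. d n * cis (of_int n * x))"

context
  fixes d :: "int \<Rightarrow> complex"
  assumes abs_summable: "(\<lambda>n. norm (d n)) summable_on UNIV"
begin

lemma summable_on_trig_series: "(\<lambda>n. d n * cis (of_int n * x)) summable_on A"
  by (rule abs_summable_summable, rule summable_on_subset_banach[OF _ subset_UNIV])
     (simp add: norm_mult abs_summable)

lemma has_sum_trig_series: "((\<lambda>n. d n * cis (of_int n * x)) has_sum trig_series d x) UNIV"
  unfolding trig_series_def by (rule has_sum_infsum[OF summable_on_trig_series])

lemma norm_trig_series_minus_partial_sum_le:
  "norm (trig_series d x - (\<Sum>n\<in>{- int N..int N}. d n * cis (of_int n * x)))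
     \<le> (\<Sum>\<^sub>\<infinity>n\<in>UNIV - {- int N..int N}. norm (d n))"
proof -
  have "trig_series d x - (\<Sum>n\<in>{- int N..int N}. d n * cis (of_int n * x))
      = (\<Sum>\<^sub>\<infinity>n\<in>UNIV - {- int N..int N}. d n * cis (of_int n * x))"
    unfolding trig_series_def by (subst infsum_Diff) (simp_all add: summable_on_trig_series)
  also have "norm \<dots> \<le> (\<Sum>\<^sub>\<infinity>n\<in>UNIV - {- int N..int N}. norm (d n * cis (of_int n * x)))"
    by (rule norm_infsum_bound)
       (simp add: norm_mult summable_on_subset_banach[OF abs_summable subset_UNIV])
  finally show ?thesis by (simp add: norm_mult)
qed

lemma tendsto_infsum_norm_outside_intervals:
  "(\<lambda>N. \<Sum>\<^sub>\<infinity>n\<in>UNIV - {- int N..int N}. norm (d n)) \<longlonglongrightarrow> 0"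
proof -
  let ?T = "\<Sum>\<^sub>\<infinity>n. norm (d n)"
  have "(sum (\<lambda>n. norm (d n)) \<longlongrightarrow> ?T) (finite_subsets_at_top UNIV)"
    by (rule infsum_tendsto[OF abs_summable])
  then have "(\<lambda>N. sum (\<lambda>n. norm (d n)) {- int N..int N}) \<longlonglongrightarrow> ?T"
    by (rule filterlim_compose[OF _ filterlim_int_symmetric_intervals])
  then have "(\<lambda>N. ?T - sum (\<lambda>n. norm (d n)) {- int N..int N}) \<longlonglongrightarrow> ?T - ?T"
    by (intro tendsto_intros)
  moreover have "?T - sum (\<lambda>n. norm (d n)) {- int N..int N}
      = (\<Sum>\<^sub>\<infinity>n\<in>UNIV - {- int N..int N}. norm (d n))" for N
    by (subst infsum_Diff) (simp_all add: abs_summable)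
  ultimately show ?thesis by simp
qed

lemma uniform_limit_trig_partial_sums:
  "uniform_limit UNIV (\<lambda>N x. \<Sum>n\<in>{- int N..int N}. d n * cis (of_int n * x)) (trig_series d) sequentially"
proof (rule uniform_limitI)
  fix e :: real assume "e > 0"
  then have "eventually (\<lambda>N. (\<Sum>\<^sub>\<infinity>n\<in>UNIV - {- int N..int N}. norm (d n)) < e) sequentially"
    using tendsto_infsum_norm_outside_intervals order_tendstoD(2) by blast
  then show "eventually (\<lambda>N. \<forall>x\<in>UNIV.
      dist (\<Sum>n\<in>{- int N..int N}. d n * cis (of_int n * x)) (trig_series d x) < e) sequentially"
  proof eventually_elim
    case (elim N)
    show ?case
      using le_less_trans[OF norm_trig_series_minus_partial_sum_le elim]
      by (simp add: dist_norm norm_minus_commute)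
  qed
qed

lemma continuous_on_trig_series: "continuous_on UNIV (trig_series d)"
  by (rule uniform_limit_theorem[OF _ uniform_limit_trig_partial_sums])
     (auto intro!: always_eventually continuous_intros)

lemma has_integral_trig_partial_sum_mult_cis:
  assumes "\<bar>m\<bar> \<le> int N"
  shows "((\<lambda>t. (\<Sum>n\<in>{- int N..int N}. d n * cis (of_int n * t)) * cis (- (of_int m * t))) has_integral
           complex_of_real (2 * pi) * d m) {0..2 * pi}"
proof -
  have "((\<lambda>t. \<Sum>n\<in>{- int N..int N}. d n * (cis (of_int n * t) * cis (- (of_int m * t)))) has_integral
      (\<Sum>n\<in>{- int N..int N}. d n * (if n = m then complex_of_real (2 * pi) else 0))) {0..2 * pi}"
    by (intro has_integral_sum has_integral_mult_right has_integral_cis_int_mult_cis_int) auto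
  moreover have "(\<Sum>n\<in>{- int N..int N}. d n * (if n = m then complex_of_real (2 * pi) else 0))
      = complex_of_real (2 * pi) * d m"
    using assms by (simp add: sum.delta mult.commute if_distrib[of "(*) (d _)"] abs_le_iff cong: if_cong)
  ultimately show ?thesis by (simp add: sum_distrib_right mult.assoc)
qed

lemma has_integral_trig_series_mult_cis:
  "((\<lambda>t. trig_series d t * cis (- (of_int m * t))) has_integral complex_of_real (2 * pi) * d m)
     {0..2 * pi}"
proof -
  let ?P = "\<lambda>N t. (\<Sum>n\<in>{- int N..int N}. d n * cis (of_int n * t)) * cis (- (of_int m * t))"
  have "uniform_limit (cbox 0 (2 * pi)) ?P (\<lambda>t. trig_series d t * cis (- (of_int m * t))) sequentially"
  proof (rule uniform_limitI)
    fix e :: real assume "e > 0"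
    with uniform_limit_trig_partial_sums
    have "eventually (\<lambda>N. \<forall>x\<in>UNIV. dist (\<Sum>n\<in>{- int N..int N}. d n * cis (of_int n * x))
        (trig_series d x) < e) sequentially"
      by (rule uniform_limitD)
    then show "eventually (\<lambda>N. \<forall>x\<in>cbox 0 (2 * pi).
        dist (?P N x) (trig_series d x * cis (- (of_int m * x))) < e) sequentially"
      by eventually_elim (simp add: dist_norm left_diff_distrib[symmetric] norm_mult)
  qed
  then obtain I J where I: "\<And>N. (?P N has_integral I N) (cbox 0 (2 * pi))"
    and J: "((\<lambda>t. trig_series d t * cis (- (of_int m * t))) has_integral J) (cbox 0 (2 * pi))"
    and lim: "I \<longlonglongrightarrow> J"
    by (rule uniform_limit_integral_cbox) (auto intro!: continuous_intros)
  have "eventually (\<lambda>N. I N = complex_of_real (2 * pi) * d m) sequentially"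
    using eventually_ge_at_top[of "nat \<bar>m\<bar>"]
  proof eventually_elim
    case (elim N)
    then have "\<bar>m\<bar> \<le> int N" by simp
    moreover have "(?P N has_integral I N) {0..2 * pi}" using I[of N] by simp
    ultimately show ?case
      using has_integral_unique has_integral_trig_partial_sum_mult_cis by blast
  qed
  then have "I \<longlonglongrightarrow> complex_of_real (2 * pi) * d m" by (rule tendsto_eventually)
  then have "J = complex_of_real (2 * pi) * d m" using lim LIMSEQ_unique by blast
  then show ?thesis using J by simp
qed

lemma trig_series_coeffs_eq_if_const:
  assumes "\<And>x. ((\<lambda>n. d n * cis (of_int n * x)) has_sum c) UNIV"
  shows "d n = (if n = 0 then c else 0)"
proof -
  have "trig_series d t = c" for t
    using has_sum_unique[OF has_sum_trig_series assms] .
  then have "((\<lambda>t. c * cis (of_int (- n) * t)) has_integral complex_of_real (2 * pi) * d n) {0..2 * pi}"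
    using has_integral_trig_series_mult_cis[of n] by simp
  moreover have "((\<lambda>t. c * cis (of_int (- n) * t)) has_integral
      c * (if - n = 0 then complex_of_real (2 * pi) else 0)) {0..2 * pi}"
    by (intro has_integral_mult_right has_integral_cis_int)
  ultimately have "complex_of_real (2 * pi) * d n = c * (if - n = 0 then complex_of_real (2 * pi) else 0)"
    by (rule has_integral_unique)
  then show ?thesis by (cases "n = 0") auto
qed

end

theorem has_sum_fourier_series:
  fixes u u' u'' :: "real \<Rightarrow> real"
  assumes u': "\<And>t. (u has_real_derivative u' t) (at t)"
    and u'': "\<And>t. (u' has_real_derivative u'' t) (at t)"
    and cont: "continuous_on UNIV u''" and per: "\<And>t. u (t + 2 * pi) = u t"
  shows "((\<lambda>n. fourier_coeff u n * cis (of_int n * x)) has_sum complex_of_real (u x)) UNIV"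
proof -
  let ?S = "trig_series (fourier_coeff u)"
  have summable: "(\<lambda>n. norm (fourier_coeff u n)) summable_on UNIV"
    by (rule abs_summable_fourier_coeff[OF u' u'' cont per])
  have u_cont: "continuous_on UNIV u"
    using u' by (intro continuous_at_imp_continuous_on) (auto intro: DERIV_isCont)
  have "complex_of_real (u t) - ?S t = 0" for t
  proof (rule periodic_eq_0_if_fourier_integrals_eq_0)
    show "continuous_on UNIV (\<lambda>t. complex_of_real (u t) - ?S t)"
      by (intro continuous_intros u_cont continuous_on_trig_series[OF summable])
    show "complex_of_real (u (t + 2 * pi)) - ?S (t + 2 * pi) = complex_of_real (u t) - ?S t" for t
      using per by (simp add: trig_series_def distrib_left cis_mult[symmetric])
    fix k :: int
    have "((\<lambda>t. complex_of_real (u t) * cis (- (of_int (- k) * t)) - ?S t * cis (- (of_int (- k) * t)))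
        has_integral of_real (2 * pi) * fourier_coeff u (- k) - of_real (2 * pi) * fourier_coeff u (- k))
        {0..2 * pi}"
      by (intro has_integral_diff has_integral_fourier_coeff u_cont
          has_integral_trig_series_mult_cis[OF summable])
    then show "((\<lambda>t. (complex_of_real (u t) - ?S t) * cis (of_int k * t)) has_integral 0) {0..2 * pi}"
      by (simp add: left_diff_distrib)
  qed
  then show ?thesis using has_sum_trig_series[OF summable, of x] by simp
qed

lemma quarter_shift_sum_const_if_has_sum_2_mod_4:
  fixes u :: "real \<Rightarrow> real"
  assumes "\<And>psi. ((\<lambda>n. c n * cis (of_int n * psi)) has_sum (complex_of_real (u psi) - c0))
      {n::int. n mod 4 = 2}"
  shows "u psi + u (psi + pi / 2) = 2 * Re c0"
proof -
  \<comment> \<open>Shifting by a quarter period multiplies every term of the series by $i^n = -1$.\<close>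
  have "c n * cis (of_int n * (psi + pi / 2)) = - (c n * cis (of_int n * psi))"
    if "n \<in> {n::int. n mod 4 = 2}" for n
    using that cis_int_quarter_eq_minus_one_iff[of n]
    by (simp add: distrib_left cis_mult[symmetric])
  then have "((\<lambda>n. c n * cis (of_int n * (psi + pi / 2))) has_sum - (complex_of_real (u psi) - c0))
      {n::int. n mod 4 = 2} \<longleftrightarrow> ((\<lambda>n. - (c n * cis (of_int n * psi))) has_sum
      - (complex_of_real (u psi) - c0)) {n::int. n mod 4 = 2}"
    by (rule has_sum_cong)
  then have "((\<lambda>n. c n * cis (of_int n * (psi + pi / 2))) has_sum - (complex_of_real (u psi) - c0))
      {n::int. n mod 4 = 2}"
    using assms[of psi] by (simp add: has_sum_uminus)
  then have "complex_of_real (u (psi + pi / 2)) - c0 = - (complex_of_real (u psi) - c0)"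
    using assms[of "psi + pi / 2"] has_sum_unique by blast
  then have "Re (complex_of_real (u psi + u (psi + pi / 2))) = Re (2 * c0)"
    by (simp add: algebra_simps)
  then show ?thesis by simp
qed

lemma fourier_coeff_quarter_shift_sum_const:
  fixes u u' u'' :: "real \<Rightarrow> real"
  assumes u': "\<And>t. (u has_real_derivative u' t) (at t)"
    and u'': "\<And>t. (u' has_real_derivative u'' t) (at t)"
    and cont: "continuous_on UNIV u''" and per: "\<And>t. u (t + 2 * pi) = u t"
    and const: "\<And>psi. u psi + u (psi + pi / 2) = C"
  shows "fourier_coeff u n * (cis (of_int n * (pi / 2)) + 1) = (if n = 0 then complex_of_real C else 0)"
proof -
  define d where "d n = fourier_coeff u n * (cis (of_int n * (pi / 2)) + 1)" for n
  have fourier: "((\<lambda>n. fourier_coeff u n * cis (of_int n * x)) has_sum complex_of_real (u x)) UNIV" for x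
    by (rule has_sum_fourier_series[OF u' u'' cont per])
  have "(\<lambda>n. norm (d n)) summable_on UNIV"
  proof (rule summable_on_comparison_test)
    show "(\<lambda>n. 2 * norm (fourier_coeff u n)) summable_on UNIV"
      by (intro summable_on_cmult_right abs_summable_fourier_coeff[OF u' u'' cont per])
    fix n
    have "norm (cis (of_int n * (pi / 2)) + 1) \<le> 2"
      using norm_triangle_ineq[of "cis (of_int n * (pi / 2))" 1] by simp
    from mult_left_mono[OF this norm_ge_zero[of "fourier_coeff u n"]]
    show "norm (d n) \<le> 2 * norm (fourier_coeff u n)"
      by (simp add: d_def norm_mult mult.commute)
  qed auto
  moreover
  \<comment> \<open>$d_n$ are the coefficients of the series of the constant $u(\psi + \pi/2) + u(\psi)$.\<close>
  have "((\<lambda>n. d n * cis (of_int n * x)) has_sum complex_of_real C) UNIV" for x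
  proof -
    have "(\<lambda>n. fourier_coeff u n * cis (of_int n * (x + pi / 2)) + fourier_coeff u n * cis (of_int n * x))
        = (\<lambda>n. d n * cis (of_int n * x))"
      by (simp add: fun_eq_iff d_def distrib_left cis_mult[symmetric] algebra_simps)
    moreover have "complex_of_real (u (x + pi / 2)) + complex_of_real (u x)
        = complex_of_real (u x + u (x + pi / 2))" by simp
    then have "complex_of_real (u (x + pi / 2)) + complex_of_real (u x) = complex_of_real C"
      by (simp only: const)
    ultimately show ?thesis using has_sum_add[OF fourier fourier, of "x + pi / 2" x] by simp
  qed
  ultimately show ?thesis unfolding d_def[symmetric] by (rule trig_series_coeffs_eq_if_const)
qed

lemma has_sum_2_mod_4_if_quarter_shift_sum_const:
  fixes u u' u'' :: "real \<Rightarrow> real"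
  assumes u': "\<And>t. (u has_real_derivative u' t) (at t)"
    and u'': "\<And>t. (u' has_real_derivative u'' t) (at t)"
    and cont: "continuous_on UNIV u''" and per: "\<And>t. u (t + 2 * pi) = u t"
    and const: "\<And>psi. u psi + u (psi + pi / 2) = C"
  shows "((\<lambda>n. fourier_coeff u n * cis (of_int n * psi)) has_sum complex_of_real (u psi - C / 2))
           {n::int. n mod 4 = 2}"
proof -
  note coeff = fourier_coeff_quarter_shift_sum_const[OF u' u'' cont per const]
  have vanish: "fourier_coeff u n = 0" if "n \<noteq> 0" "n mod 4 \<noteq> 2" for n
    using coeff[of n] that cis_int_quarter_eq_minus_one_iff[of n] by (auto simp: add_eq_0_iff add.commute)
  have "fourier_coeff u 0 = complex_of_real (C / 2)" using coeff[of 0] by simp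
  moreover have "((\<lambda>n. fourier_coeff u n * cis (of_int n * psi)) has_sum
      (complex_of_real (u psi) - fourier_coeff u 0)) (UNIV - {0})"
    using has_sum_Diff[OF has_sum_fourier_series[OF u' u'' cont per] has_sum_finite[of "{0}"]] by simp
  ultimately have "((\<lambda>n. fourier_coeff u n * cis (of_int n * psi)) has_sum
      complex_of_real (u psi - C / 2)) (UNIV - {0})"
    by (simp only: of_real_diff)
  moreover have "((\<lambda>n. fourier_coeff u n * cis (of_int n * psi)) has_sum complex_of_real (u psi - C / 2))
      (UNIV - {0}) \<longleftrightarrow> ((\<lambda>n. fourier_coeff u n * cis (of_int n * psi)) has_sum
      complex_of_real (u psi - C / 2)) {n::int. n mod 4 = 2}"
    by (rule has_sum_cong_neutral) (auto simp: vanish)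
  ultimately show ?thesis by blast
qed

section \<open>Lemmas on plane vectors and real functions\<close>

lemma weighted_chords_eq_iff:
  fixes p q r s :: real
  assumes "\<bar>q\<bar> < s" "\<bar>r\<bar> < p"
  shows "(p - r) * sqrt ((p + r)\<^sup>2 + (q + s)\<^sup>2) = (p + r) * sqrt ((p - r)\<^sup>2 + (q - s)\<^sup>2)
    \<longleftrightarrow> p * q = r * s"
proof -
  have "\<bar>q\<bar> * \<bar>r\<bar> < s * p"
    using assms by (meson abs_ge_zero le_less_trans mult_strict_mono')
  then have "p * s - q * r \<noteq> 0" by (auto simp: abs_mult[symmetric] mult.commute)
  have key: "(p - r)\<^sup>2 * ((p + r)\<^sup>2 + (q + s)\<^sup>2) - (p + r)\<^sup>2 * ((p - r)\<^sup>2 + (q - s)\<^sup>2)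
      = 4 * (p * s - q * r) * (p * q - r * s)"
    by (simp add: algebra_simps power2_eq_square)
  have "p - r > 0" "p + r > 0" using assms(2) by auto
  then have "(p - r) * sqrt ((p + r)\<^sup>2 + (q + s)\<^sup>2) = (p + r) * sqrt ((p - r)\<^sup>2 + (q - s)\<^sup>2)
      \<longleftrightarrow> sqrt ((p - r)\<^sup>2 * ((p + r)\<^sup>2 + (q + s)\<^sup>2)) = sqrt ((p + r)\<^sup>2 * ((p - r)\<^sup>2 + (q - s)\<^sup>2))"
    by (simp add: real_sqrt_mult)
  also have "\<dots> \<longleftrightarrow> 4 * (p * s - q * r) * (p * q - r * s) = 0"
    unfolding key[symmetric] by (simp only: real_sqrt_eq_iff right_minus_eq)
  also have "\<dots> \<longleftrightarrow> p * q = r * s" using \<open>p * s - q * r \<noteq> 0\<close> by simp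
  finally show ?thesis .
qed

lemma cross_eq_0_if_scaled_eq:
  fixes P1 P2 Q1 Q2 \<alpha> \<beta> :: real
  assumes "\<alpha> * P1 = \<beta> * Q1" "\<alpha> * P2 = \<beta> * Q2" "\<alpha> \<noteq> 0 \<or> \<beta> \<noteq> 0"
  shows "P1 * Q2 - P2 * Q1 = 0"
proof -
  have "\<alpha> * (P1 * Q2 - P2 * Q1) = (\<alpha> * P1) * Q2 - (\<alpha> * P2) * Q1" by (simp add: algebra_simps)
  also have "\<dots> = 0" unfolding assms(1,2) by (simp add: algebra_simps)
  moreover have "\<beta> * (P1 * Q2 - P2 * Q1) = P1 * (\<beta> * Q2) - P2 * (\<beta> * Q1)" by (simp add: algebra_simps)
  moreover have "\<dots> = 0" unfolding assms(1,2)[symmetric] by (simp add: algebra_simps)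
  ultimately have "\<alpha> * (P1 * Q2 - P2 * Q1) = 0" "\<beta> * (P1 * Q2 - P2 * Q1) = 0" by simp_all
  then show ?thesis using assms(3) by auto
qed

lemma orthogonal_if_orthogonal_to_sum_and_diff:
  fixes u1 u2 v1 v2 a1 a2 b1 b2 :: real
  assumes "u1\<^sup>2 + u2\<^sup>2 = 1" "v1\<^sup>2 + v2\<^sup>2 = 1"
    and "(u1 + v1, u2 + v2) \<noteq> (0, 0)" "(u1 - v1, u2 - v2) \<noteq> (0, 0)"
    and b: "b1 * (u1 + v1) + b2 * (u2 + v2) = 0" and a: "a1 * (u1 - v1) + a2 * (u2 - v2) = 0"
  shows "a1 * b1 + a2 * b2 = 0"
proof -
  define w1 w2 z1 z2 where "w1 = u1 + v1" "w2 = u2 + v2" "z1 = u1 - v1" "z2 = u2 - v2"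
  have w: "w1\<^sup>2 + w2\<^sup>2 \<noteq> 0" and z: "z1\<^sup>2 + z2\<^sup>2 \<noteq> 0"
    using assms(3,4) by (auto simp: w1_w2_z1_z2_def sum_power2_eq_zero_iff)
  have wz: "w1 * z1 + w2 * z2 = 0"
    using assms(1,2) by (simp add: w1_w2_z1_z2_def algebra_simps power2_eq_square)
  have bw: "b1 * w1 + b2 * w2 = 0" and az: "a1 * z1 + a2 * z2 = 0"
    using a b by (simp_all add: w1_w2_z1_z2_def)
  \<comment> \<open>In the plane, $b \perp w$ and $z \perp w \neq 0$ force $b \parallel z$.\<close>
  have "(b1 * z2 - b2 * z1) * (w1\<^sup>2 + w2\<^sup>2)
      = (w1 * b1 + w2 * b2) * (w1 * z2 - w2 * z1) - (w1 * z1 + w2 * z2) * (w1 * b2 - w2 * b1)"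
    by (simp add: algebra_simps power2_eq_square)
  then have "(b1 * z2 - b2 * z1) * (w1\<^sup>2 + w2\<^sup>2) = 0" using wz bw by (simp add: algebra_simps)
  then have bz: "b1 * z2 - b2 * z1 = 0" using w mult_eq_0_iff by blast
  have "(a1 * b1 + a2 * b2) * (z1\<^sup>2 + z2\<^sup>2)
      = (a1 * z1 + a2 * z2) * (b1 * z1 + b2 * z2) + (a1 * z2 - a2 * z1) * (b1 * z2 - b2 * z1)"
    by (simp add: algebra_simps power2_eq_square)
  then have "(a1 * b1 + a2 * b2) * (z1\<^sup>2 + z2\<^sup>2) = 0" using az bz by simp
  then show ?thesis using z mult_eq_0_iff by blast
qed

lemma orthogonal_if_bisecting_chords:
  fixes p1 p2 q1 q2 a1 a2 b1 b2 d1 d2 :: real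
  assumes cross: "p1 * q2 - p2 * q1 \<noteq> 0"
    and d1: "d1 = sqrt ((p1 - q1)\<^sup>2 + (p2 - q2)\<^sup>2)" and d2: "d2 = sqrt ((p1 + q1)\<^sup>2 + (p2 + q2)\<^sup>2)"
    and b: "b1 * ((p1 - q1) / d1 - (p1 + q1) / d2) + b2 * ((p2 - q2) / d1 - (p2 + q2) / d2) = 0"
    and a: "a1 * ((p1 - q1) / d1 + (p1 + q1) / d2) + a2 * ((p2 - q2) / d1 + (p2 + q2) / d2) = 0"
  shows "a1 * b1 + a2 * b2 = 0"
proof -
  \<comment> \<open>$u$ and $v$ are the unit vectors from $q$ to $p$ and to $-p$.\<close>
  define u1 u2 v1 v2 where "u1 = (p1 - q1) / d1" "u2 = (p2 - q2) / d1"
    "v1 = - (p1 + q1) / d2" "v2 = - (p2 + q2) / d2"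
  have sum_diff: "u1 + v1 = (p1 - q1) / d1 - (p1 + q1) / d2" "u2 + v2 = (p2 - q2) / d1 - (p2 + q2) / d2"
    "u1 - v1 = (p1 - q1) / d1 + (p1 + q1) / d2" "u2 - v2 = (p2 - q2) / d1 + (p2 + q2) / d2"
    unfolding u1_u2_v1_v2_def by (simp_all add: diff_divide_distrib add_divide_distrib)
  have nz: "(p1 - q1, p2 - q2) \<noteq> (0, 0)" "(p1 + q1, p2 + q2) \<noteq> (0, 0)"
    using cross by (auto simp: add_eq_0_iff)
  then have "d1 > 0" "d2 > 0" unfolding d1 d2 by (auto simp: sum_power2_eq_zero_iff add_nonneg_pos
        add_pos_nonneg)
  have "u1\<^sup>2 + u2\<^sup>2 = ((p1 - q1)\<^sup>2 + (p2 - q2)\<^sup>2) / d1\<^sup>2"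
    unfolding u1_u2_v1_v2_def by (simp add: power_divide add_divide_distrib)
  moreover have "v1\<^sup>2 + v2\<^sup>2 = ((p1 + q1)\<^sup>2 + (p2 + q2)\<^sup>2) / d2\<^sup>2"
    unfolding u1_u2_v1_v2_def by (simp add: power_divide add_divide_distrib power2_eq_square algebra_simps)
  ultimately have "u1\<^sup>2 + u2\<^sup>2 = 1" "v1\<^sup>2 + v2\<^sup>2 = 1"
    using nz by (simp_all add: d1 d2 sum_power2_eq_zero_iff)
  moreover have "(u1 + v1, u2 + v2) \<noteq> (0, 0)" "(u1 - v1, u2 - v2) \<noteq> (0, 0)"
    using cross_eq_0_if_scaled_eq[of "d2 - d1" p1 "d1 + d2" q1 p2 q2]
      cross_eq_0_if_scaled_eq[of "d1 + d2" p1 "d2 - d1" q1 p2 q2] cross \<open>d1 > 0\<close> \<open>d2 > 0\<close>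
    by (auto simp: u1_u2_v1_v2_def field_simps)
  moreover have "b1 * (u1 + v1) + b2 * (u2 + v2) = 0" "a1 * (u1 - v1) + a2 * (u2 - v2) = 0"
    using a b by (simp_all only: sum_diff)
  ultimately show ?thesis by (rule orthogonal_if_orthogonal_to_sum_and_diff)
qed

lemma abs_diff_le_if_deriv_bounded:
  fixes f f' :: "real \<Rightarrow> real"
  assumes "\<And>t. t \<in> ball a s \<Longrightarrow> (f has_real_derivative f' t) (at t)"
    and "\<And>t. t \<in> ball a s \<Longrightarrow> \<bar>f' t\<bar> \<le> B" and "y \<in> ball a s"
  shows "\<bar>f y - f a\<bar> \<le> B * \<bar>y - a\<bar>"
proof -
  have "norm (f y - f a) \<le> B * norm (y - a)"
  proof (rule field_differentiable_bound[of "ball a s"])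
    fix t assume "t \<in> ball a s"
    then show "(f has_field_derivative f' t) (at t within ball a s)"
      by (rule has_field_derivative_at_within[OF assms(1)])
    show "norm (f' t) \<le> B" using assms(2) \<open>t \<in> ball a s\<close> by simp
  next
    have "dist a y < s" using assms(3) by simp
    then have "0 < s" using zero_le_dist[of a y] by linarith
    then show "a \<in> ball a s" by simp
  qed (use assms(3) in auto)
  then show ?thesis by simp
qed

lemma envelope_has_real_derivative_0:
  fixes G g :: "real \<Rightarrow> real \<Rightarrow> real" and F :: "real \<Rightarrow> real"
  assumes F_cont: "isCont F a" and "\<delta> > 0"
    and deriv: "\<And>t b. t \<in> ball a \<delta> \<Longrightarrow> b \<in> ball (F a) \<delta> \<Longrightarrow> ((\<lambda>t. G t b) has_real_derivative g t b) (at t)"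
    and max: "\<And>t b. t \<in> ball a \<delta> \<Longrightarrow> b \<in> ball (F a) \<delta> \<Longrightarrow> G t b \<le> G t (F t)"
    and g_cont: "isCont (\<lambda>z. g (fst z) (snd z)) (a, F a)" and g_0: "g a (F a) = 0"
  shows "((\<lambda>t. G t (F t)) has_real_derivative 0) (at a)"
  unfolding has_field_derivative_iff
proof (rule LIM_I)
  fix r :: real assume "r > 0"
  then have "r / 2 > 0" by simp
  with g_cont obtain d1 where "d1 > 0"
    and "\<And>z. dist z (a, F a) < d1 \<Longrightarrow> dist (g (fst z) (snd z)) (g a (F a)) < r / 2"
    unfolding continuous_at_eps_delta by fastforce
  then have d1: "\<bar>g (fst z) (snd z)\<bar> < r / 2" if "dist z (a, F a) < d1" for z
    using that g_0 by (simp add: dist_real_def)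
  define \<epsilon> where "\<epsilon> = min d1 \<delta> / 2"
  have "\<epsilon> > 0" using \<open>d1 > 0\<close> \<open>\<delta> > 0\<close> by (simp add: \<epsilon>_def)
  obtain d2 where "d2 > 0" and d2: "\<And>y. dist y a < d2 \<Longrightarrow> dist (F y) (F a) < \<epsilon>"
    using F_cont \<open>\<epsilon> > 0\<close> unfolding continuous_at_eps_delta by blast
  define s where "s = min d2 \<epsilon>"
  have "s > 0" using \<open>d2 > 0\<close> \<open>\<epsilon> > 0\<close> by (simp add: s_def)
  have "s \<le> \<epsilon>" "\<epsilon> \<le> \<delta>" "2 * \<epsilon> \<le> d1" using \<open>\<delta> > 0\<close> by (auto simp: s_def \<epsilon>_def)
  \<comment> \<open>Near $(a, F a)$ the partial derivative $g$ is small, so $G$ is almost constant in its first argument.\<close>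
  have bound: "\<bar>G y b - G a b\<bar> \<le> r / 2 * \<bar>y - a\<bar>" if "y \<in> ball a s" "b \<in> ball (F a) \<epsilon>" for y b
  proof (rule abs_diff_le_if_deriv_bounded[OF _ _ that(1)])
    fix t assume t: "t \<in> ball a s"
    then show "((\<lambda>t. G t b) has_real_derivative g t b) (at t)"
      using that(2) \<open>s \<le> \<epsilon>\<close> \<open>\<epsilon> \<le> \<delta>\<close> by (intro deriv) auto
    have "dist (t, b) (a, F a) \<le> dist t a + dist b (F a)"
      using sqrt_sum_squares_le_sum_abs[of "dist t a" "dist b (F a)"] by (simp add: dist_Pair_Pair)
    also have "\<dots> < d1"
      using t that(2) \<open>s \<le> \<epsilon>\<close> \<open>2 * \<epsilon> \<le> d1\<close> by (simp add: dist_commute)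
    finally show "\<bar>g t b\<bar> \<le> r / 2" using d1[of "(t, b)"] by simp
  qed
  show "\<exists>s>0. \<forall>y. y \<noteq> a \<and> norm (y - a) < s \<longrightarrow> norm ((G y (F y) - G a (F a)) / (y - a) - 0) < r"
  proof (intro exI[of _ s] conjI allI impI)
    show "s > 0" by fact
    fix y assume y: "y \<noteq> a \<and> norm (y - a) < s"
    then have "y \<in> ball a s" "F y \<in> ball (F a) \<epsilon>" "F a \<in> ball (F a) \<epsilon>"
      using d2[of y] \<open>\<epsilon> > 0\<close> by (auto simp: s_def dist_norm norm_minus_commute)
    moreover have "y \<in> ball a \<delta>" "a \<in> ball a \<delta>" "F y \<in> ball (F a) \<delta>" "F a \<in> ball (F a) \<delta>"
      using calculation \<open>s \<le> \<epsilon>\<close> \<open>\<epsilon> \<le> \<delta>\<close> \<open>\<delta> > 0\<close> by auto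
    ultimately have "G y (F y) - G a (F a) \<le> r / 2 * \<bar>y - a\<bar>"
      "G a (F a) - G y (F y) \<le> r / 2 * \<bar>y - a\<bar>"
      using abs_le_D1[OF bound[of y "F y"]] abs_le_D2[OF bound[of y "F a"]] max[of y "F a"] max[of a "F y"]
      by auto
    then have "\<bar>G y (F y) - G a (F a)\<bar> \<le> r / 2 * \<bar>y - a\<bar>" by linarith
    then have "\<bar>(G y (F y) - G a (F a)) / (y - a)\<bar> \<le> r / 2"
      using y by (simp add: abs_divide divide_le_eq)
    then show "norm ((G y (F y) - G a (F a)) / (y - a) - 0) < r"
      using \<open>r > 0\<close> by (simp only: real_norm_def diff_zero)
  qed
qed

lemma deriv_eq_0_if_vanishes_on_ball:
  fixes f :: "real \<Rightarrow> real"
  assumes "(f has_real_derivative f') (at s)" "s \<in> ball t e" "\<And>x. x \<in> ball t e \<Longrightarrow> f x = 0"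
  shows "f' = 0"
proof (rule DERIV_local_const[OF assms(1)])
  show "0 < e - dist t s" using assms(2) by simp
  show "\<forall>y. \<bar>s - y\<bar> < e - dist t s \<longrightarrow> f s = f y"
    using assms(2,3) dist_triangle[of t _ s] by (auto simp: dist_real_def)
qed

section \<open>Support functions, chords and the reflection law\<close>

locale support_function =
  fixes h :: "real \<Rightarrow> real"
  assumes C2: "C2_fun h" and periodic: "periodic_2pi h"
    and curvature_pos: "\<And>psi. h psi + deriv (deriv h) psi > 0"
begin

definition h1 :: "real \<Rightarrow> real" where "h1 = deriv h"
definition h2 :: "real \<Rightarrow> real" where "h2 = deriv h1"
definition curv_radius :: "real \<Rightarrow> real" where "curv_radius t = h t + h2 t"

lemma h_deriv: "(h has_real_derivative h1 t) (at t)"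
  using C2 unfolding C2_fun_def h1_def by (simp add: DERIV_deriv_iff_real_differentiable)

lemma h1_deriv: "(h1 has_real_derivative h2 t) (at t)"
  using C2 unfolding C2_fun_def h1_def h2_def by (simp add: DERIV_deriv_iff_real_differentiable)

lemma h2_cont: "continuous_on UNIV h2"
  using C2 unfolding C2_fun_def h1_def h2_def by simp

lemma h2_isCont: "isCont h2 t"
  using h2_cont by (simp add: continuous_on_eq_continuous_at)

lemma h_isCont: "isCont h t"
  using h_deriv DERIV_isCont by blast

lemma h1_isCont: "isCont h1 t"
  using h1_deriv DERIV_isCont by blast

lemma curv_radius_pos: "curv_radius t > 0"
  using curvature_pos[of t] unfolding curv_radius_def h2_def h1_def by simp

lemma curv_radius_isCont: "isCont curv_radius t"
  unfolding curv_radius_def[abs_def] by (intro continuous_intros h_isCont h2_isCont)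

lemma h_periodic: "h (t + 2 * pi) = h t"
  using periodic unfolding periodic_2pi_def by simp

lemma h1_periodic: "h1 (t + 2 * pi) = h1 t"
  by (rule periodic_deriv[OF h_deriv h_periodic])

lemma h2_periodic: "h2 (t + 2 * pi) = h2 t"
  by (rule periodic_deriv[OF h1_deriv h1_periodic])

lemma curv_radius_periodic: "curv_radius (t + 2 * pi) = curv_radius t"
  unfolding curv_radius_def by (simp add: h_periodic h2_periodic)

definition px :: "real \<Rightarrow> real" where "px t = h t * cos t - h1 t * sin t"
definition py :: "real \<Rightarrow> real" where "py t = h t * sin t + h1 t * cos t"

lemma px_deriv: "(px has_real_derivative - (curv_radius t * sin t)) (at t)"
  unfolding px_def[abs_def]
  by (rule derivative_eq_intros h_deriv h1_deriv refl | simp add: curv_radius_def algebra_simps)+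

lemma py_deriv: "(py has_real_derivative (curv_radius t * cos t)) (at t)"
  unfolding py_def[abs_def]
  by (rule derivative_eq_intros h_deriv h1_deriv refl | simp add: curv_radius_def algebra_simps)+

lemma px_isCont: "isCont px t" using px_deriv DERIV_isCont by blast
lemma py_isCont: "isCont py t" using py_deriv DERIV_isCont by blast

lemma px_periodic: "px (t + 2 * pi) = px t" unfolding px_def by (simp add: h_periodic h1_periodic)
lemma py_periodic: "py (t + 2 * pi) = py t" unfolding py_def by (simp add: h_periodic h1_periodic)

lemma bpoint_eq: "bpoint h t = Complex (px t) (py t)"
  unfolding bpoint_def px_def py_def h1_def
  by (simp add: complex_eq_iff cis.sel)

text \<open>Coordinates of the boundary point with normal angle t along the outer normal cis s and along
  the tangent \<i> * cis s at the boundary point with normal angle s.\<close>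
definition nproj :: "real \<Rightarrow> real \<Rightarrow> real" where "nproj s t = px t * cos s + py t * sin s"
definition tproj :: "real \<Rightarrow> real \<Rightarrow> real" where "tproj s t = - px t * sin s + py t * cos s"

lemma nproj_alt: "nproj s t = h t * cos (t - s) - h1 t * sin (t - s)"
  unfolding nproj_def px_def py_def cos_diff sin_diff by (simp add: algebra_simps)

lemma tproj_alt: "tproj s t = h t * sin (t - s) + h1 t * cos (t - s)"
  unfolding tproj_def px_def py_def cos_diff sin_diff by (simp add: algebra_simps)

lemma nproj_self: "nproj s s = h s" by (simp add: nproj_alt)
lemma tproj_self: "tproj s s = h1 s" by (simp add: tproj_alt)

lemma nproj_periodic: "nproj s (t + 2 * pi) = nproj s t"
  unfolding nproj_def by (simp add: px_periodic py_periodic)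

lemma nproj_deriv: "((\<lambda>t. nproj s t) has_real_derivative - (curv_radius t * sin (t - s))) (at t)"
  unfolding nproj_def
  by (rule derivative_eq_intros px_deriv py_deriv refl | simp add: sin_diff algebra_simps)+

lemma nproj_less_h:
  assumes "s < t" "t < s + 2 * pi"
  shows "nproj s t < h s"
proof (cases "t \<le> s + pi")
  case True
  have "nproj s t < nproj s s"
  proof (rule DERIV_neg_imp_decreasing_open[OF assms(1)])
    fix x assume "s < x" "x < t"
    then have "sin (x - s) > 0" using True by (intro sin_gt_zero) auto
    then show "\<exists>y. ((\<lambda>t. nproj s t) has_real_derivative y) (at x) \<and> y < 0"
      using nproj_deriv curv_radius_pos by (metis mult_pos_pos neg_less_0_iff_less)
  next
    show "continuous_on {s..t} (nproj s)"
      using nproj_deriv by (intro continuous_at_imp_continuous_on) (metis DERIV_isCont)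
  qed
  then show ?thesis by (simp add: nproj_self)
next
  case False
  have "nproj s t < nproj s (s + 2 * pi)"
  proof (rule DERIV_pos_imp_increasing_open[OF assms(2)])
    fix x assume "t < x" "x < s + 2 * pi"
    then have "sin (x - s) < 0" using False by (intro sin_lt_zero) auto
    then show "\<exists>y. ((\<lambda>t. nproj s t) has_real_derivative y) (at x) \<and> y > 0"
      using nproj_deriv curv_radius_pos by (metis mult_pos_neg neg_0_less_iff_less)
  next
    show "continuous_on {t..s + 2 * pi} (nproj s)"
      using nproj_deriv by (intro continuous_at_imp_continuous_on) (metis DERIV_isCont)
  qed
  then show ?thesis by (simp add: nproj_periodic nproj_self)
qed

definition chord :: "real \<Rightarrow> real \<Rightarrow> real" where "chord a b = sqrt ((px a - px b)\<^sup>2 + (py a - py b)\<^sup>2)"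

text \<open>Cosine of the angle between the chord from the point with normal angle s to the point with
  normal angle t and the tangent \<i> * cis s; the reflection law at s is the vanishing of a sum of two
  such cosines.\<close>
definition chord_tan :: "real \<Rightarrow> real \<Rightarrow> real" where
  "chord_tan s t = (tproj s t - tproj s s) / chord t s"

lemma chord_sym: "chord a b = chord b a"
  unfolding chord_def by (simp add: power2_commute)

lemma chord_nonneg: "chord a b \<ge> 0" unfolding chord_def by simp

lemma chord_shift_left: "chord (a + 2 * pi) b = chord a b" unfolding chord_def by (simp add: px_periodic py_periodic)
lemma chord_shift_right: "chord a (b + 2 * pi) = chord a b" unfolding chord_def by (simp add: px_periodic py_periodic)

lemma chord_zero_nproj: "chord a b = 0 \<Longrightarrow> nproj s a = nproj s b"
  unfolding chord_def nproj_def by simp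

lemma chord_pos: assumes "a < b" "b < a + 2 * pi" shows "chord a b > 0"
proof -
  have "nproj a b < h a" using nproj_less_h assms by blast
  then have "chord a b \<noteq> 0" using chord_zero_nproj[of a b a] nproj_self by force
  then show ?thesis using chord_nonneg[of a b] by linarith
qed

lemma chord_pos': assumes "b < a" "a < b + 2 * pi" shows "chord a b > 0"
  using chord_pos[OF assms] chord_sym by simp

lemma isCont_chord: "isCont (\<lambda>z. chord (fst z) (snd z)) z"
  unfolding chord_def by (intro continuous_intros isCont_o2[OF _ px_isCont] isCont_o2[OF _ py_isCont])

lemma chord_deriv:
  assumes "chord t s > 0"
  shows "((\<lambda>t. chord t s) has_real_derivative - (curv_radius t * chord_tan t s)) (at t)"
proof -
  let ?Q = "\<lambda>t. (px t - px s)\<^sup>2 + (py t - py s)\<^sup>2"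
  have Q: "(?Q has_real_derivative 2 * (px t - px s) * (- (curv_radius t * sin t)) + 2 * (py t - py s) * (curv_radius t * cos t)) (at t)"
    by (auto intro!: derivative_eq_intros px_deriv py_deriv simp: algebra_simps)
  have Qpos: "?Q t > 0" using assms unfolding chord_def by simp
  have "((\<lambda>t. sqrt (?Q t)) has_real_derivative
      inverse (sqrt (?Q t)) / 2 * (2 * (px t - px s) * (- (curv_radius t * sin t)) + 2 * (py t - py s) * (curv_radius t * cos t))) (at t)"
    by (rule DERIV_chain2[OF DERIV_real_sqrt[OF Qpos] Q])
  moreover have "inverse (sqrt (?Q t)) / 2 * (2 * (px t - px s) * (- (curv_radius t * sin t)) + 2 * (py t - py s) * (curv_radius t * cos t))
     = - (curv_radius t * chord_tan t s)"
    using Qpos unfolding chord_tan_def tproj_def chord_sym[of s t] unfolding chord_def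
    by (simp add: field_simps divide_simps)
  ultimately show ?thesis unfolding chord_def by simp
qed

lemma lagrange_identity:
  "(sin t * sin s + cos t * cos s) * ((px t - px s)\<^sup>2 + (py t - py s)\<^sup>2)
     + (tproj s t - tproj s s) * (tproj t s - tproj t t)
   = (nproj s t - nproj s s) * (nproj t t - nproj t s)"
  unfolding nproj_def tproj_def by (simp add: algebra_simps power2_eq_square)

lemma tproj_deriv: "((\<lambda>t. tproj s t) has_real_derivative curv_radius t * (sin t * sin s + cos t * cos s)) (at t)"
  unfolding tproj_def
  by (auto intro!: derivative_eq_intros px_deriv py_deriv simp: algebra_simps)

lemma chord_tan_deriv:
  assumes "chord t s > 0"
  shows "((\<lambda>t. chord_tan s t) has_real_derivative curv_radius t * (nproj s t - h s) * (h t - nproj t s) / (chord t s)^3) (at t)"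
proof -
  have d: "((\<lambda>t. (tproj s t - tproj s s) / chord t s) has_real_derivative
     ((curv_radius t * (sin t * sin s + cos t * cos s)) * chord t s - (tproj s t - tproj s s) * (- (curv_radius t * chord_tan t s))) / (chord t s * chord t s)) (at t)"
    by (rule DERIV_divide) (use assms in \<open>auto intro!: derivative_eq_intros tproj_deriv chord_deriv\<close>)
  have Q: "(chord t s)\<^sup>2 = (px t - px s)\<^sup>2 + (py t - py s)\<^sup>2" unfolding chord_def by simp
  have "((curv_radius t * (sin t * sin s + cos t * cos s)) * chord t s - (tproj s t - tproj s s) * (- (curv_radius t * chord_tan t s))) / (chord t s * chord t s)
     = curv_radius t * ((sin t * sin s + cos t * cos s) * (chord t s)\<^sup>2 + (tproj s t - tproj s s) * (tproj t s - tproj t t)) / (chord t s)^3"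
    using assms unfolding chord_tan_def chord_sym[of s t] by (simp add: field_simps power2_eq_square power3_eq_cube less_imp_neq[symmetric])
  also have "\<dots> = curv_radius t * (nproj s t - h s) * (h t - nproj t s) / (chord t s)^3"
    unfolding Q lagrange_identity by (simp add: nproj_self)
  finally show ?thesis using d unfolding chord_tan_def[abs_def] by simp
qed

lemma tproj_periodic: "tproj s (t + 2 * pi) = tproj s t"
  unfolding tproj_def by (simp add: px_periodic py_periodic)

lemma tproj_shift_left: "tproj (s + 2 * pi) t = tproj s t" unfolding tproj_def by simp

lemma chord_tan_shift_right: "chord_tan s (t + 2 * pi) = chord_tan s t"
  unfolding chord_tan_def by (simp add: tproj_periodic chord_shift_left)

lemma chord_tan_shift: "chord_tan (s + 2 * pi) (t + 2 * pi) = chord_tan s t"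
  unfolding chord_tan_def by (simp add: tproj_periodic tproj_shift_left chord_shift_left chord_shift_right)

lemma nproj_less_h': assumes "t < s" "s < t + 2 * pi" shows "nproj s t < h s"
  using nproj_less_h[of s "t + 2 * pi"] assms nproj_periodic by simp

lemma chord_tan_deriv_neg:
  assumes "s < t" "t < s + 2 * pi"
  shows "((\<lambda>t. chord_tan s t) has_real_derivative curv_radius t * (nproj s t - h s) * (h t - nproj t s) / (chord t s)^3) (at t)
     \<and> curv_radius t * (nproj s t - h s) * (h t - nproj t s) / (chord t s)^3 < 0"
proof
  have D: "chord t s > 0" using chord_pos'[OF assms] .
  then show "((\<lambda>t. chord_tan s t) has_real_derivative curv_radius t * (nproj s t - h s) * (h t - nproj t s) / (chord t s)^3) (at t)"
    by (rule chord_tan_deriv)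
  have "nproj s t - h s < 0" using nproj_less_h[OF assms] by simp
  moreover have "h t - nproj t s > 0" using nproj_less_h'[of s t] assms by simp
  ultimately have "curv_radius t * (nproj s t - h s) * (h t - nproj t s) < 0"
    using curv_radius_pos[of t] by (simp add: mult_pos_neg mult_neg_pos)
  then show "curv_radius t * (nproj s t - h s) * (h t - nproj t s) / (chord t s)^3 < 0"
    using D by (simp add: divide_neg_pos)
qed

lemma chord_tan_strict_decreasing:
  assumes "s < t1" "t1 < t2" "t2 < s + 2 * pi"
  shows "chord_tan s t2 < chord_tan s t1"
proof (rule DERIV_neg_imp_decreasing_open[OF assms(2)])
  fix x assume "t1 < x" "x < t2"
  then show "\<exists>y. ((\<lambda>t. chord_tan s t) has_real_derivative y) (at x) \<and> y < 0"
    using chord_tan_deriv_neg[of s x] assms by auto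
next
  show "continuous_on {t1..t2} (chord_tan s)"
  proof (intro continuous_at_imp_continuous_on ballI)
    fix x assume "x \<in> {t1..t2}"
    then show "isCont (chord_tan s) x"
      using chord_tan_deriv_neg[of s x] assms DERIV_isCont by auto
  qed
qed

lemma reflects_iff_chord_tan: "reflects h a b c \<longleftrightarrow> chord_tan b a + chord_tan b c = 0"
proof -
  have e: "sgn (Complex (px u) (py u) - Complex (px b) (py b)) = Complex ((px u - px b)/chord u b) ((py u - py b)/chord u b)" for u
  proof -
    have eqc: "Complex (px u) (py u) - Complex (px b) (py b) = Complex (px u - px b) (py u - py b)"
      by (simp add: complex_eq_iff)
    show ?thesis unfolding eqc sgn_div_norm by (simp add: complex_eq_iff chord_def divide_inverse mult.commute complex_norm)
  qed
  have "Re ((Complex ((px a - px b)/chord a b) ((py a - py b)/chord a b) + Complex ((px c - px b)/chord c b) ((py c - py b)/chord c b))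
      * cnj (\<i> * cis b)) = chord_tan b a + chord_tan b c"
    unfolding chord_tan_def tproj_def by (simp add: chord_sym[of b] diff_divide_distrib add_divide_distrib algebra_simps)
  then show ?thesis unfolding reflects_def Let_def bpoint_eq e by simp
qed

lemma sum_sq_rotation:
  fixes X Y S C :: real
  shows "(X * C + Y * S)\<^sup>2 + (- X * S + Y * C)\<^sup>2 = (X\<^sup>2 + Y\<^sup>2) * (S\<^sup>2 + C\<^sup>2)"
  by (simp add: algebra_simps power2_eq_square)

lemma chord_eq_rotated: "chord u v = sqrt ((nproj c u - nproj c v)\<^sup>2 + (tproj c u - tproj c v)\<^sup>2)"
proof -
  have "(nproj c u - nproj c v)\<^sup>2 + (tproj c u - tproj c v)\<^sup>2
      = ((px u - px v) * cos c + (py u - py v) * sin c)\<^sup>2 + (- (px u - px v) * sin c + (py u - py v) * cos c)\<^sup>2"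
    unfolding nproj_def tproj_def by (simp add: algebra_simps)
  also have "\<dots> = (px u - px v)\<^sup>2 + (py u - py v)\<^sup>2"
    unfolding sum_sq_rotation by simp
  finally show ?thesis unfolding chord_def by simp
qed

lemma isCont_chord_tan_comp:
  fixes f g :: "'a::real_normed_vector \<Rightarrow> real"
  assumes "isCont f x" "isCont g x" "chord (g x) (f x) \<noteq> 0"
  shows "isCont (\<lambda>x. chord_tan (f x) (g x)) x"
proof -
  have "isCont (\<lambda>x. chord (g x) (f x)) x"
    using isCont_o2[OF isCont_Pair[OF assms(2) assms(1)] isCont_chord] by simp
  then show ?thesis unfolding chord_tan_def[abs_def] tproj_def
    by (intro continuous_intros isCont_o2[OF _ px_isCont] isCont_o2[OF _ py_isCont] assms)
qed

end

locale centrally_symmetric = support_function +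
  assumes h_shift_pi: "\<And>t. h (t + pi) = h t"
begin

lemma h1_shift_pi: "h1 (t + pi) = h1 t" by (rule periodic_deriv[OF h_deriv h_shift_pi])

lemma px_shift_pi: "px (t + pi) = - px t" unfolding px_def by (simp add: h_shift_pi h1_shift_pi)
lemma py_shift_pi: "py (t + pi) = - py t" unfolding py_def by (simp add: h_shift_pi h1_shift_pi)
lemma px_shift_minus_pi: "px (t - pi) = - px t" using px_shift_pi[of "t - pi"] by simp
lemma py_shift_minus_pi: "py (t - pi) = - py t" using py_shift_pi[of "t - pi"] by simp

lemma nproj_shift_pi: "nproj s (t + pi) = - nproj s t"
  unfolding nproj_def by (simp add: px_shift_pi py_shift_pi)
lemma tproj_shift_pi: "tproj s (t + pi) = - tproj s t"
  unfolding tproj_def by (simp add: px_shift_pi py_shift_pi)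

lemma h_pos: "h t > 0"
  using nproj_less_h[of t "t + pi"] nproj_shift_pi[of t t] nproj_self[of t] by simp

lemma chord_shift_pi: "chord (a + pi) (b + pi) = chord a b"
  unfolding chord_def px_shift_pi py_shift_pi by (simp add: algebra_simps power2_commute)

lemma chord_shift_minus_pi: "chord (a - pi) (b - pi) = chord a b"
  using chord_shift_pi[of "a - pi" "b - pi"] by simp

lemma reflects_quarter_iff:
  "chord_tan (a + pi / 2) a + chord_tan (a + pi / 2) (a + pi) = 0
     \<longleftrightarrow> h a * h1 a + h (a + pi / 2) * h1 (a + pi / 2) = 0"
proof -
  define b where "b = a + pi / 2"
  \<comment> \<open>Coordinates along the normal and the tangent at $a$: $X(a) = (p, q)$, $X(b) = (r, s)$.\<close>
  define p q r s where "p = h a" "q = h1 a" "r = - h1 b" "s = h b"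
  have ab: "a - b = - (pi / 2)" "a + pi - b = pi / 2" "b - a = pi / 2" unfolding b_def by simp_all
  have "a < b" "b < a + pi" "b < a + 2 * pi" unfolding b_def by simp_all
  have nproj_ab: "nproj a b = r" and tproj_ab: "tproj a b = s" and nproj_ba: "nproj b a = q"
    unfolding nproj_alt tproj_alt ab p_q_r_s_def by simp_all
  have chord1: "chord a b = sqrt ((p - r)\<^sup>2 + (q - s)\<^sup>2)"
    unfolding chord_eq_rotated[of a b a] nproj_self tproj_self nproj_ab tproj_ab p_q_r_s_def ..
  have chord2: "chord (a + pi) b = sqrt ((p + r)\<^sup>2 + (q + s)\<^sup>2)"
    unfolding chord_eq_rotated[of "a + pi" b a] nproj_shift_pi tproj_shift_pi nproj_self tproj_self
      nproj_ab tproj_ab p_q_r_s_def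
    by (simp add: power2_commute algebra_simps)
  have tan1: "chord_tan b a = (r - p) / chord a b"
    unfolding chord_tan_def tproj_alt ab p_q_r_s_def chord_sym[of a b] by simp
  have tan2: "chord_tan b (a + pi) = (p + r) / chord (a + pi) b"
    unfolding chord_tan_def tproj_alt ab p_q_r_s_def chord_sym[of "a + pi" b]
    by (simp add: h_shift_pi h1_shift_pi)
  have "chord a b > 0" "chord (a + pi) b > 0"
    using \<open>a < b\<close> \<open>b < a + pi\<close> by (auto intro: chord_pos chord_pos')
  have "\<bar>q\<bar> < s" "\<bar>r\<bar> < p"
  proof -
    have "q < s" "- q < s" "r < p" "- r < p"
      using nproj_less_h'[of a b] nproj_less_h[of b "a + pi"] nproj_less_h[of a b]
        nproj_less_h[of a "b + pi"] \<open>a < b\<close> \<open>b < a + pi\<close> \<open>b < a + 2 * pi\<close>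
      unfolding nproj_shift_pi nproj_ab nproj_ba by (simp_all add: p_q_r_s_def)
    then show "\<bar>q\<bar> < s" "\<bar>r\<bar> < p" by auto
  qed
  have "chord_tan b a + chord_tan b (a + pi) = 0 \<longleftrightarrow> (p - r) * chord (a + pi) b = (p + r) * chord a b"
    unfolding tan1 tan2 using \<open>chord a b > 0\<close> \<open>chord (a + pi) b > 0\<close>
    by (simp add: field_simps) argo
  also have "\<dots> \<longleftrightarrow> p * q = r * s"
    unfolding chord1 chord2 by (rule weighted_chords_eq_iff) fact+
  finally show ?thesis by (simp add: p_q_r_s_def b_def algebra_simps) argo
qed

lemma abs_nproj_less_h:
  assumes "s < t" "t < s + pi"
  shows "\<bar>nproj s t\<bar> < h s"
  using nproj_less_h[of s t] nproj_less_h[of s "t + pi"] nproj_shift_pi[of s t] assms by auto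

lemma abs_nproj_less_h':
  assumes "t < s" "s < t + pi"
  shows "\<bar>nproj s t\<bar> < h s"
  using nproj_less_h'[of t s] nproj_less_h[of s "t + pi"] nproj_shift_pi[of s t] assms by auto

lemma bpoints_independent:
  assumes "a < b" "b < a + pi"
  shows "px a * py b - py a * px b \<noteq> 0"
proof
  assume "px a * py b - py a * px b = 0"
  moreover have "nproj a b * nproj b a - nproj a a * nproj b b
     = (px b * py a - px a * py b) * (cos a * sin b - sin a * cos b)"
    unfolding nproj_def by (simp add: algebra_simps)
  ultimately have "nproj a b * nproj b a = h a * h b" by (simp add: nproj_self)
  moreover have "\<bar>nproj a b\<bar> * \<bar>nproj b a\<bar> < h a * h b"
    using abs_nproj_less_h[OF assms] abs_nproj_less_h'[OF assms]
    by (meson abs_ge_zero le_less_trans mult_strict_mono')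
  ultimately show False by (simp add: abs_mult[symmetric] h_pos)
qed

lemma quarter_if_reflects_symmetric:
  assumes ab: "a < b" "b < a + pi"
    and at_b: "chord_tan b a + chord_tan b (a + pi) = 0"
    and at_a: "chord_tan a (b - pi) + chord_tan a b = 0"
  shows "b = a + pi / 2"
proof -
  define d1 d2 where "d1 = chord a b" "d2 = chord (a + pi) b"
  have "d1 > 0" "d2 > 0" using ab by (auto simp: d1_d2_def intro: chord_pos chord_pos')
  have d1: "d1 = sqrt ((px a - px b)\<^sup>2 + (py a - py b)\<^sup>2)" by (simp add: d1_d2_def chord_def)
  have d2: "d2 = sqrt ((px a + px b)\<^sup>2 + (py a + py b)\<^sup>2)"
    unfolding d1_d2_def chord_def px_shift_pi py_shift_pi by (simp add: power2_commute algebra_simps)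
  have d_sym: "chord b a = d1" "chord (b - pi) a = d2"
    using chord_sym[of a b] chord_shift_minus_pi[of b "a + pi"] chord_sym[of "a + pi" b]
    by (simp_all add: d1_d2_def)
  have tan: "chord_tan b a = (- sin b * (px a - px b) + cos b * (py a - py b)) / d1"
    "chord_tan b (a + pi) = (- sin b * (- px a - px b) + cos b * (- py a - py b)) / d2"
    "chord_tan a (b - pi) = (- sin a * (- px b - px a) + cos a * (- py b - py a)) / d2"
    "chord_tan a b = (- sin a * (px b - px a) + cos a * (py b - py a)) / d1"
    unfolding chord_tan_def tproj_def d_sym d1_d2_def[symmetric] px_shift_pi py_shift_pi
      px_shift_minus_pi py_shift_minus_pi
    by (simp_all add: algebra_simps)
  have "(- sin b) * ((px a - px b) / d1 - (px a + px b) / d2)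
      + cos b * ((py a - py b) / d1 - (py a + py b) / d2) = chord_tan b a + chord_tan b (a + pi)"
    "(- sin a) * ((px a - px b) / d1 + (px a + px b) / d2)
      + cos a * ((py a - py b) / d1 + (py a + py b) / d2) = - (chord_tan a (b - pi) + chord_tan a b)"
    unfolding tan using \<open>d1 > 0\<close> \<open>d2 > 0\<close> by (simp add: field_simps)+
  then have "(- sin b) * ((px a - px b) / d1 - (px a + px b) / d2)
      + cos b * ((py a - py b) / d1 - (py a + py b) / d2) = 0"
    "(- sin a) * ((px a - px b) / d1 + (px a + px b) / d2)
      + cos a * ((py a - py b) / d1 + (py a + py b) / d2) = 0"
    using at_a at_b by simp_all
  then have "(- sin a) * (- sin b) + cos a * cos b = 0"
    by (rule orthogonal_if_bisecting_chords[OF bpoints_independent[OF ab] d1 d2])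
  then have "cos (b - a) = 0" by (simp add: cos_diff algebra_simps)
  then have "b - a = pi / 2" using cos_inj_pi[of "b - a" "pi / 2"] ab by simp
  then show ?thesis by simp
qed

theorem has_rot_inv_curve_4_if_quarter_condition:
  assumes "\<And>a. h a * h1 a + h (a + pi / 2) * h1 (a + pi / 2) = 0"
  shows "has_rot_inv_curve_4 h"
  unfolding has_rot_inv_curve_4_def
proof (intro exI[of _ "\<lambda>psi. psi + pi / 2"] conjI allI)
  fix psi :: real
  have "chord_tan (psi + pi / 2) psi + chord_tan (psi + pi / 2) (psi + pi) = 0"
    using reflects_quarter_iff[of psi] assms[of psi] by simp
  moreover have "psi + pi / 2 + pi / 2 = psi + pi" by simp
  ultimately show "reflects h psi (psi + pi / 2) (psi + pi / 2 + pi / 2)"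
    by (simp only: reflects_iff_chord_tan)
qed (auto intro: continuous_intros simp: numeral_eq_Suc)

end

section \<open>Invariant curves of 4-periodic orbits\<close>

locale invariant_curve_4 = support_function +
  fixes F :: "real \<Rightarrow> real"
  assumes F_cont: "continuous_on UNIV F"
    and F_shift_2pi: "\<And>psi. F (psi + 2 * pi) = F psi + 2 * pi"
    and F_greater: "\<And>psi. psi < F psi" and F_less: "\<And>psi. F psi < psi + 2 * pi"
    and F_power_4: "\<And>psi. (F ^^ 4) psi = psi + 2 * pi"
    and F_reflects: "\<And>psi. reflects h psi (F psi) (F (F psi))"
begin

lemma F_F_F_F: "F (F (F (F psi))) = psi + 2 * pi"
  using F_power_4[of psi] by (simp add: numeral_eq_Suc)

lemma isCont_F: "isCont F x"
  using F_cont by (simp add: continuous_on_eq_continuous_at)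

lemma F_shift_minus_2pi: "F (psi - 2 * pi) = F psi - 2 * pi"
  using F_shift_2pi[of "psi - 2 * pi"] by simp

lemma inj_F: "inj F"
proof
  fix x y assume "F x = F y"
  then have "F (F (F (F x))) = F (F (F (F y)))" by simp
  then show "x = y" by (simp add: F_F_F_F)
qed

lemma strict_mono_F: "strict_mono F"
proof
  fix x y :: real assume "x < y"
  have "(F x < F y \<and> F y < F (y + 2 * pi)) \<or> (F (y + 2 * pi) < F y \<and> F y < F x)"
    using \<open>x < y\<close> continuous_on_subset[OF F_cont] inj_on_subset[OF inj_F]
    by (intro continuous_inj_imp_mono) auto
  then show "F x < F y" using F_shift_2pi[of y] by auto
qed

definition F_inv :: "real \<Rightarrow> real" where "F_inv x = F (F (F x)) - 2 * pi"

lemma F_F_inv: "F (F_inv x) = x"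
  unfolding F_inv_def using F_shift_minus_2pi F_F_F_F by simp

lemma F_inv_F: "F_inv (F x) = x"
  unfolding F_inv_def using F_F_F_F by simp

lemma F_inv_less: "F_inv x < x" using F_greater[of "F_inv x"] F_F_inv by simp
lemma F_inv_greater: "x - 2 * pi < F_inv x" using F_less[of "F_inv x"] F_F_inv by simp

lemma reflects_at: "chord_tan b (F_inv b) + chord_tan b (F b) = 0"
  using F_reflects[of "F_inv b"] unfolding reflects_iff_chord_tan F_F_inv .

definition slope :: "real \<Rightarrow> real" where "slope b = curv_radius b * chord_tan b (F b)"

lemma slope_F_inv: "slope b = - curv_radius b * chord_tan b (F_inv b)"
proof -
  have "chord_tan b (F b) = - chord_tan b (F_inv b)" using reflects_at[of b] by linarith
  then show ?thesis by (simp add: slope_def)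
qed

lemma isCont_slope: "isCont slope x"
proof -
  have "chord (F x) x \<noteq> 0" using chord_pos'[OF F_greater[of x] F_less[of x]] by simp
  then show ?thesis unfolding slope_def[abs_def]
    by (intro continuous_intros curv_radius_isCont isCont_chord_tan_comp isCont_F) auto
qed

lemma slope_shift_2pi: "slope (x + 2 * pi) = slope x"
  unfolding slope_def by (simp add: F_shift_2pi chord_tan_shift curv_radius_periodic)

definition U :: "real \<Rightarrow> real" where "U = (SOME U. \<forall>x. (U has_real_derivative slope x) (at x))"

lemma U_deriv: "(U has_real_derivative slope x) (at x)"
proof -
  have "\<exists>U. \<forall>x::real. -\<infinity> < ereal x \<longrightarrow> ereal x < \<infinity> \<longrightarrow> (U has_vector_derivative slope x) (at x)"
    by (rule einterval_antiderivative) (auto intro: isCont_slope)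
  then have "\<exists>U. \<forall>x. (U has_real_derivative slope x) (at x)"
    by (auto simp: has_real_derivative_iff_has_vector_derivative)
  from someI_ex[OF this] show ?thesis unfolding U_def by blast
qed

lemma U_shift_2pi: "U (x + 2 * pi) - U x = U (2 * pi) - U 0"
proof -
  have "((\<lambda>x. U (x + 2 * pi)) has_real_derivative slope (x + 2 * pi) * 1) (at x)" for x
    by (rule DERIV_chain2[OF U_deriv]) (auto intro!: derivative_eq_intros)
  then have "((\<lambda>x. U (x + 2 * pi) - U x) has_real_derivative slope (x + 2 * pi) * 1 - slope x) (at x)" for x
    by (intro derivative_intros U_deriv)
  then have "((\<lambda>x. U (x + 2 * pi) - U x) has_real_derivative 0) (at x)" for x
    by (simp add: slope_shift_2pi)
  then show ?thesis using DERIV_isconst_all[of "\<lambda>x. U (x + 2 * pi) - U x" x 0] by simp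
qed

definition gen :: "real \<Rightarrow> real \<Rightarrow> real" where "gen a b = chord b a - U b + U a"

lemma gen_deriv_right:
  assumes "a < t" "t < a + 2 * pi"
  shows "((\<lambda>t. gen a t) has_real_derivative curv_radius t * (chord_tan t (F_inv t) - chord_tan t a)) (at t)"
proof -
  have "chord t a > 0" using chord_pos' assms by simp
  then have "((\<lambda>t. chord t a - U t + U a) has_real_derivative - (curv_radius t * chord_tan t a) - slope t + 0) (at t)"
    by (intro derivative_intros chord_deriv U_deriv)
  then show ?thesis unfolding gen_def[abs_def] slope_F_inv by (simp add: algebra_simps)
qed

lemma gen_deriv_left:
  assumes "t < b" "b < t + 2 * pi"
  shows "((\<lambda>t. gen t b) has_real_derivative curv_radius t * (chord_tan t (F t) - chord_tan t b)) (at t)"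
proof -
  have "chord t b > 0" using chord_pos assms by simp
  then have "((\<lambda>t. chord t b - U b + U t) has_real_derivative - (curv_radius t * chord_tan t b) - 0 + slope t) (at t)"
    by (intro derivative_intros chord_deriv U_deriv)
  then show ?thesis unfolding gen_def[abs_def] slope_def chord_sym[of b] by (simp add: algebra_simps)
qed

lemma gen_deriv_right_sign:
  assumes "a < t" "t < a + 2 * pi"
  shows "t < F a \<Longrightarrow> curv_radius t * (chord_tan t (F_inv t) - chord_tan t a) > 0"
    and "F a < t \<Longrightarrow> curv_radius t * (chord_tan t (F_inv t) - chord_tan t a) < 0"
proof -
  have "t < F_inv t + 2 * pi" "a + 2 * pi < t + 2 * pi"
    using F_inv_greater[of t] assms by auto
  moreover have "t < a + 2 * pi" "F_inv t + 2 * pi < t + 2 * pi"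
    using F_inv_less[of t] assms by auto
  moreover have "F_inv t < a \<longleftrightarrow> t < F a" "a < F_inv t \<longleftrightarrow> F a < t"
    using strict_mono_less[OF strict_mono_F] F_F_inv by metis+
  ultimately show "t < F a \<Longrightarrow> curv_radius t * (chord_tan t (F_inv t) - chord_tan t a) > 0"
    and "F a < t \<Longrightarrow> curv_radius t * (chord_tan t (F_inv t) - chord_tan t a) < 0"
    using chord_tan_strict_decreasing[of t "F_inv t + 2 * pi" "a + 2 * pi"]
      chord_tan_strict_decreasing[of t "a + 2 * pi" "F_inv t + 2 * pi"] curv_radius_pos[of t]
    by (auto simp: chord_tan_shift_right intro: mult_pos_pos mult_pos_neg)
qed

lemma gen_less_gen_F:
  assumes "a < b" "b < a + 2 * pi" "b \<noteq> F a"
  shows "gen a b < gen a (F a)"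
proof -
  have cont: "continuous_on {c..d} (gen a)" if "a < c" "d < a + 2 * pi" for c d
  proof (intro continuous_at_imp_continuous_on ballI)
    fix t assume "t \<in> {c..d}"
    then have "a < t" "t < a + 2 * pi" using that by auto
    then show "isCont (gen a) t" by (rule DERIV_isCont[OF gen_deriv_right])
  qed
  show ?thesis
  proof (cases "b < F a")
    case True
    then show ?thesis
      using assms F_less[of a] gen_deriv_right gen_deriv_right_sign(1)
      by (intro DERIV_pos_imp_increasing_open[OF True] cont) (auto, meson less_trans)
  next
    case False
    then have "F a < b" using assms(3) by simp
    then show ?thesis
      using assms F_greater[of a] gen_deriv_right gen_deriv_right_sign(2)
      by (intro DERIV_neg_imp_decreasing_open[OF \<open>F a < b\<close>] cont) (auto, meson less_trans)
  qed
qed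

lemma gen_le_gen_F: "a < b \<Longrightarrow> b < a + 2 * pi \<Longrightarrow> gen a b \<le> gen a (F a)"
  using gen_less_gen_F by (cases "b = F a") (auto simp: less_imp_le)

definition gen_max :: real where "gen_max = gen 0 (F 0)"

lemma gen_F_eq_gen_max: "gen a (F a) = gen_max"
proof -
  have "((\<lambda>t. gen t (F t)) has_real_derivative 0) (at a)" for a
  proof -
    \<comment> \<open>Envelope argument: $gen\ t\ (F\ t)$ is the maximum of $gen\ t$, and $\partial_t gen$ vanishes at $(t, F\ t)$.\<close>
    define \<delta> where "\<delta> = min (F a - a) (a + 2 * pi - F a) / 2"
    have "\<delta> > 0" using F_greater[of a] F_less[of a] by (simp add: \<delta>_def)
    have near: "t < b" "b < t + 2 * pi" if "t \<in> ball a \<delta>" "b \<in> ball (F a) \<delta>" for t b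
      using that by (auto simp: \<delta>_def dist_real_def abs_if split: if_split_asm)
    have "isCont (\<lambda>z. chord_tan (fst z) (snd z)) (a, F a)"
      "isCont (\<lambda>z. chord_tan (fst z) (F (fst z))) (a, F a)"
      using chord_pos'[OF F_greater[of a] F_less[of a]]
      by (auto intro!: isCont_chord_tan_comp continuous_intros isCont_o2[OF _ isCont_F])
    then have "isCont (\<lambda>z. curv_radius (fst z) * (chord_tan (fst z) (F (fst z)) - chord_tan (fst z) (snd z))) (a, F a)"
      by (intro continuous_intros isCont_o2[OF _ curv_radius_isCont])
    then show ?thesis
      using near gen_deriv_left gen_le_gen_F
      by (intro envelope_has_real_derivative_0[OF isCont_F \<open>\<delta> > 0\<close>,
            where g = "\<lambda>t b. curv_radius t * (chord_tan t (F t) - chord_tan t b)"]) auto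
  qed
  then show ?thesis unfolding gen_max_def by (intro DERIV_isconst_all) auto
qed

lemma gen_le_gen_max: "a < b \<Longrightarrow> b < a + 2 * pi \<Longrightarrow> gen a b \<le> gen_max"
  using gen_le_gen_F gen_F_eq_gen_max by metis

lemma gen_less_gen_max: "a < b \<Longrightarrow> b < a + 2 * pi \<Longrightarrow> b \<noteq> F a \<Longrightarrow> gen a b < gen_max"
  using gen_less_gen_F gen_F_eq_gen_max by metis

definition cyclic_quad :: "(nat \<Rightarrow> real) \<Rightarrow> bool" where
  "cyclic_quad z \<longleftrightarrow> (\<forall>k<4. z k < z (Suc k) \<and> z (Suc k) < z k + 2 * pi) \<and> z 4 = z 0 + 2 * pi"

definition perimeter :: "(nat \<Rightarrow> real) \<Rightarrow> real" where
  "perimeter z = (\<Sum>k<4. chord (z (Suc k)) (z k))"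

definition max_perimeter :: real where
  "max_perimeter = 4 * gen_max + (U (2 * pi) - U 0)"

lemma perimeter_eq_sum_gen:
  assumes "cyclic_quad z"
  shows "perimeter z = (\<Sum>k<4. gen (z k) (z (Suc k))) + (U (2 * pi) - U 0)"
proof -
  have "perimeter z = (\<Sum>k<4. gen (z k) (z (Suc k))) + (\<Sum>k<4. U (z (Suc k)) - U (z k))"
    unfolding perimeter_def gen_def by (simp add: sum.distrib[symmetric])
  also have "(\<Sum>k<4. U (z (Suc k)) - U (z k)) = U (z 4) - U (z 0)"
    by (rule sum_lessThan_telescope)
  also have "\<dots> = U (2 * pi) - U 0"
    using assms U_shift_2pi[of "z 0"] by (simp add: cyclic_quad_def)
  finally show ?thesis .
qed

lemma orbit_if_perimeter_max:
  assumes "cyclic_quad z" "perimeter z = max_perimeter" "k < 4"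
  shows "z (Suc k) = F (z k)"
proof (rule ccontr)
  assume "z (Suc k) \<noteq> F (z k)"
  then have "gen (z k) (z (Suc k)) < gen_max"
    using assms by (intro gen_less_gen_max) (auto simp: cyclic_quad_def)
  then have "(\<Sum>k<4. gen (z k) (z (Suc k))) < (\<Sum>k<(4::nat). gen_max)"
    using assms by (intro sum_strict_mono_ex1) (auto simp: cyclic_quad_def intro: gen_le_gen_max)
  then show False using assms(2) by (simp add: perimeter_eq_sum_gen[OF assms(1)] max_perimeter_def)
qed

lemma cyclic_quad_orbit: "cyclic_quad (\<lambda>k. (F ^^ k) x)"
  by (simp add: cyclic_quad_def F_greater F_less F_power_4)

lemma perimeter_orbit: "perimeter (\<lambda>k. (F ^^ k) x) = max_perimeter"
proof -
  have "(\<Sum>k<4. gen ((F ^^ k) x) ((F ^^ Suc k) x)) = (\<Sum>k<(4::nat). gen_max)"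
    by (simp add: gen_F_eq_gen_max)
  then show ?thesis by (simp add: perimeter_eq_sum_gen[OF cyclic_quad_orbit] max_perimeter_def)
qed

lemma funpow_F_shift_2pi: "(F ^^ k) (x + 2 * pi) = (F ^^ k) x + 2 * pi"
  by (induction k) (simp_all add: F_shift_2pi)

lemma funpow_F_add_4: "(F ^^ (k + 4)) x = (F ^^ k) x + 2 * pi"
  by (simp add: funpow_add F_power_4 funpow_F_shift_2pi)

end

locale symmetric_invariant_curve_4 = invariant_curve_4 + centrally_symmetric
begin

lemma perimeter_half_turn:
  assumes "\<And>k. z (k + 4) = z k + 2 * pi"
  shows "perimeter (\<lambda>k. z (k + 2) - pi) = perimeter z"
proof -
  have "perimeter (\<lambda>k. z (k + 2) - pi) = chord (z 3) (z 2) + chord (z 4) (z 3) + chord (z 5) (z 4)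
      + chord (z 6) (z 5)"
    by (simp add: perimeter_def eval_nat_numeral chord_shift_minus_pi)
  also have "\<dots> = perimeter z"
    using assms[of 0] assms[of 1] assms[of 2]
    by (simp add: perimeter_def eval_nat_numeral chord_shift_left chord_shift_right)
  finally show ?thesis .
qed

theorem F_F_eq_add_pi: "F (F x0) = x0 + pi"
proof -
  define x where "x k = (F ^^ k) x0" for k
  have x_Suc: "x (Suc k) = F (x k)" and x_add_4: "x (k + 4) = x k + 2 * pi" for k
    by (simp_all add: x_def funpow_F_add_4)
  define y where "y k = x (k + 2) - pi" for k
  \<comment> \<open>The half-turn image of an orbit is again a maximal quadrilateral, hence an orbit.\<close>
  have "cyclic_quad y"
    unfolding cyclic_quad_def y_def
  proof (intro conjI allI impI)
    fix k :: nat
    show "x (k + 2) - pi < x (Suc k + 2) - pi" "x (Suc k + 2) - pi < x (k + 2) - pi + 2 * pi"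
      using F_greater[of "x (k + 2)"] F_less[of "x (k + 2)"] x_Suc[of "k + 2"] by simp_all
  next
    show "x (4 + 2) - pi = x (0 + 2) - pi + 2 * pi" using x_add_4[of 2] by (simp add: numeral_2_eq_2)
  qed
  moreover have "perimeter y = perimeter x"
    unfolding y_def by (rule perimeter_half_turn[of x, OF x_add_4])
  then have "perimeter y = max_perimeter"
    using perimeter_orbit[of x0] by (simp add: x_def[abs_def])
  ultimately have y_Suc: "y (Suc k) = F (y k)" if "k < 4" for k
    using orbit_if_perimeter_max that by blast
  have y0: "y 0 = F (F x0) - pi" by (simp add: y_def x_def numeral_2_eq_2)
  have y2: "y 2 = F (F (y 0))" using y_Suc[of 0] y_Suc[of 1] by (simp add: numeral_2_eq_2)
  have y2': "y 2 = x0 + pi" using x_add_4[of 0] by (simp add: y_def x_def)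
  \<comment> \<open>Two orbits of the strictly increasing $F$ cannot cross.\<close>
  have "x0 < y 0 \<longleftrightarrow> F (F x0) < F (F (y 0))" by (simp add: strict_mono_less[OF strict_mono_F])
  also have "\<dots> \<longleftrightarrow> y 0 < x0" using y0 y2 y2' by auto
  finally have "y 0 = x0" by (cases "x0 < y 0") auto
  then show ?thesis using y0 by simp
qed

theorem quarter_condition:
  "h a * h1 a + h (a + pi / 2) * h1 (a + pi / 2) = 0"
proof -
  have F_shift_pi: "F (t + pi) = F t + pi" for t
    using F_F_eq_add_pi[of t] F_F_eq_add_pi[of "F t"] by simp
  define b where "b = F a"
  have Fb: "F b = a + pi" unfolding b_def by (rule F_F_eq_add_pi)
  have "a < b" "b < a + pi" using F_greater[of a] F_greater[of b] Fb by (auto simp: b_def)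
  moreover have "chord_tan b a + chord_tan b (a + pi) = 0"
    using reflects_at[of b] Fb F_inv_F[of a] by (simp add: b_def)
  moreover have "F_inv a = b - pi"
    using F_inv_F[of "b - pi"] F_shift_pi[of "b - pi"] Fb by simp
  then have "chord_tan a (b - pi) + chord_tan a b = 0"
    using reflects_at[of a] by (simp add: b_def)
  ultimately have "b = a + pi / 2" by (rule quarter_if_reflects_symmetric)
  then show ?thesis using reflects_quarter_iff[of a] \<open>chord_tan b a + chord_tan b (a + pi) = 0\<close> by simp
qed

end

section \<open>The Fourier condition\<close>

context support_function
begin

lemma h_shift_deriv: "((\<lambda>s. h (s + c)) has_real_derivative h1 (t + c)) (at t)"
  unfolding DERIV_shift[symmetric] by (rule h_deriv)

lemma h1_shift_deriv: "((\<lambda>s. h1 (s + c)) has_real_derivative h2 (t + c)) (at t)"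
  unfolding DERIV_shift[symmetric] by (rule h1_deriv)

lemma h_shift_pi_if_sq:
  assumes sq: "\<And>t. (h (t + pi))\<^sup>2 = (h t)\<^sup>2"
  shows "h (t + pi) = h t"
proof (rule ccontr)
  assume "h (t + pi) \<noteq> h t"
  \<comment> \<open>Then $h(s + \pi) = -h(s)$ near $t$; differentiating twice, the radii of curvature at $t$ and $t + \pi$ add up to $0$.\<close>
  then have "h t - h (t + pi) \<noteq> 0" by simp
  moreover have "isCont (\<lambda>s. h s - h (s + pi)) t"
    by (intro continuous_intros h_isCont isCont_o2[OF _ h_isCont])
  ultimately obtain e where "e > 0" and ne: "\<And>s. dist t s < e \<Longrightarrow> h s - h (s + pi) \<noteq> 0"
    using continuous_at_avoid by blast
  have zero: "h s + h (s + pi) = 0" if "s \<in> ball t e" for s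
  proof -
    have "(h s + h (s + pi)) * (h s - h (s + pi)) = 0"
      using sq[of s] by (simp add: power2_eq_square algebra_simps)
    then show ?thesis using ne[of s] that by simp
  qed
  have zero': "h1 s + h1 (s + pi) = 0" if "s \<in> ball t e" for s
    using deriv_eq_0_if_vanishes_on_ball[OF DERIV_add[OF h_deriv h_shift_deriv] that zero] .
  have "t \<in> ball t e" using \<open>e > 0\<close> by simp
  then have "h2 t + h2 (t + pi) = 0"
    by (rule deriv_eq_0_if_vanishes_on_ball[OF DERIV_add[OF h1_deriv[of t] h1_shift_deriv[of pi t]] _ zero'])
  then have "curv_radius t + curv_radius (t + pi) = 0" using zero[OF \<open>t \<in> ball t e\<close>] by (simp add: curv_radius_def)
  then show False using curv_radius_pos[of t] curv_radius_pos[of "t + pi"] by simp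
qed

lemma sq_sum_const_iff:
  "(\<exists>C. \<forall>s. (h s)\<^sup>2 + (h (s + pi / 2))\<^sup>2 = C)
     \<longleftrightarrow> (\<forall>a. h a * h1 a + h (a + pi / 2) * h1 (a + pi / 2) = 0)"
proof -
  have deriv: "((\<lambda>s. (h s)\<^sup>2 + (h (s + pi / 2))\<^sup>2) has_real_derivative
      2 * (h a * h1 a + h (a + pi / 2) * h1 (a + pi / 2))) (at a)" for a
    by (rule derivative_eq_intros h_deriv h_shift_deriv refl | simp add: algebra_simps)+
  show ?thesis
  proof
    assume "\<exists>C. \<forall>s. (h s)\<^sup>2 + (h (s + pi / 2))\<^sup>2 = C"
    then obtain C where C: "(\<lambda>s. (h s)\<^sup>2 + (h (s + pi / 2))\<^sup>2) = (\<lambda>_. C)" by auto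
    show "\<forall>a. h a * h1 a + h (a + pi / 2) * h1 (a + pi / 2) = 0"
    proof
      fix a
      have "((\<lambda>_. C) has_real_derivative 2 * (h a * h1 a + h (a + pi / 2) * h1 (a + pi / 2))) (at a)"
        using deriv[of a] unfolding C .
      then have "2 * (h a * h1 a + h (a + pi / 2) * h1 (a + pi / 2)) = 0"
        using DERIV_const DERIV_unique by blast
      then show "h a * h1 a + h (a + pi / 2) * h1 (a + pi / 2) = 0" by simp
    qed
  next
    assume "\<forall>a. h a * h1 a + h (a + pi / 2) * h1 (a + pi / 2) = 0"
    then have "\<forall>s. (h s)\<^sup>2 + (h (s + pi / 2))\<^sup>2 = (h 0)\<^sup>2 + (h (0 + pi / 2))\<^sup>2"
      using deriv by (intro allI DERIV_isconst_all) auto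
    then show "\<exists>C. \<forall>s. (h s)\<^sup>2 + (h (s + pi / 2))\<^sup>2 = C" by blast
  qed
qed

lemma fourier_cond_iff_sq_sum_const:
  "fourier_cond h \<longleftrightarrow> (\<exists>C. \<forall>s. (h s)\<^sup>2 + (h (s + pi / 2))\<^sup>2 = C)"
proof
  assume "fourier_cond h"
  then obtain c0 c where "\<And>psi. ((\<lambda>n. c n * cis (of_int n * psi)) has_sum
      (complex_of_real ((h psi)\<^sup>2) - c0)) {n::int. n mod 4 = 2}"
    unfolding fourier_cond_def by blast
  then have "(h s)\<^sup>2 + (h (s + pi / 2))\<^sup>2 = 2 * Re c0" for s
    by (rule quarter_shift_sum_const_if_has_sum_2_mod_4)
  then show "\<exists>C. \<forall>s. (h s)\<^sup>2 + (h (s + pi / 2))\<^sup>2 = C" by blast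
next
  assume "\<exists>C. \<forall>s. (h s)\<^sup>2 + (h (s + pi / 2))\<^sup>2 = C"
  then obtain C where C: "\<And>s. (h s)\<^sup>2 + (h (s + pi / 2))\<^sup>2 = C" by blast
  have "((\<lambda>s. (h s)\<^sup>2) has_real_derivative 2 * h t * h1 t) (at t)"
    "((\<lambda>s. 2 * h s * h1 s) has_real_derivative 2 * (h1 t)\<^sup>2 + 2 * h t * h2 t) (at t)" for t
    by (rule derivative_eq_intros h_deriv h1_deriv refl | simp add: power2_eq_square algebra_simps)+
  moreover have "continuous_on UNIV (\<lambda>t. 2 * (h1 t)\<^sup>2 + 2 * h t * h2 t)"
    by (intro continuous_at_imp_continuous_on ballI continuous_intros h_isCont h1_isCont h2_isCont)
  ultimately have "((\<lambda>n. fourier_coeff (\<lambda>s. (h s)\<^sup>2) n * cis (of_int n * psi)) has_sum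
      complex_of_real ((h psi)\<^sup>2 - C / 2)) {n::int. n mod 4 = 2}" for psi
    using h_periodic C by (intro has_sum_2_mod_4_if_quarter_shift_sum_const) auto
  then show "fourier_cond h" unfolding fourier_cond_def of_real_diff by blast
qed

lemma fourier_cond_iff_quarter_condition:
  "fourier_cond h \<longleftrightarrow> (\<forall>a. h a * h1 a + h (a + pi / 2) * h1 (a + pi / 2) = 0)"
  using fourier_cond_iff_sq_sum_const sq_sum_const_iff by blast

lemma h_shift_pi_if_sq_sum_const:
  assumes "\<And>s. (h s)\<^sup>2 + (h (s + pi / 2))\<^sup>2 = C"
  shows "h (t + pi) = h t"
proof (rule h_shift_pi_if_sq)
  show "(h (s + pi))\<^sup>2 = (h s)\<^sup>2" for s
    using assms[of s] assms[of "s + pi / 2"] by (simp add: add.assoc)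
qed

end

theorem proposition3p1:
  fixes h :: "real \<Rightarrow> real"
  assumes "C2_fun h" and "periodic_2pi h"
    and "\<forall>psi. h psi + deriv (deriv h) psi > 0"
  shows "((\<forall>psi. h (psi + pi) = h psi) \<and> has_rot_inv_curve_4 h) \<longleftrightarrow> fourier_cond h"
proof -
  interpret support_function h using assms by unfold_locales auto
  show ?thesis
  proof
    assume "(\<forall>psi. h (psi + pi) = h psi) \<and> has_rot_inv_curve_4 h"
    then obtain F where "symmetric_invariant_curve_4 h F"
      unfolding has_rot_inv_curve_4_def symmetric_invariant_curve_4_def invariant_curve_4_def
        invariant_curve_4_axioms_def centrally_symmetric_def centrally_symmetric_axioms_def
      using support_function_axioms by blast
    then show "fourier_cond h"
      using symmetric_invariant_curve_4.quarter_condition fourier_cond_iff_quarter_condition by blast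
  next
    assume "fourier_cond h"
    then obtain C where "\<And>s. (h s)\<^sup>2 + (h (s + pi / 2))\<^sup>2 = C"
      unfolding fourier_cond_iff_sq_sum_const by blast
    then have symmetric: "h (t + pi) = h t" for t by (rule h_shift_pi_if_sq_sum_const)
    then interpret centrally_symmetric h by unfold_locales
    show "(\<forall>psi. h (psi + pi) = h psi) \<and> has_rot_inv_curve_4 h"
      using symmetric \<open>fourier_cond h\<close> fourier_cond_iff_quarter_condition
        has_rot_inv_curve_4_if_quarter_condition by blast
  qed
qed

end
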